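(* There exists a $1$-Ahlfors regular and purely $1$-unrectifiable set $E\subset\mathbb{H}$ such that the singular integral associated with $K_b$ and $E$ is bounded in $L^2(E)$, i.e. there is a constant $C>0$ such that the truncated singular integrals $$T^b_\varepsilon f(p):=\int_{E\setminus B(p,\varepsilon)}K_b(p^{-1}\cdot q)\,f(q)\,d\mathcal{H}^1(q)$$ satisfy $\|T^b_\varepsilon f\|_{L^2(E)}\le C\|f\|_{L^2(E)}$ for all $f\in L^2(E)$ and all $\varepsilon>0$. Moreover, for every $p\in E$ we have $(p^{-1}E)\setminus\{0\}\subset\{K_b\neq0\}$.
   Context: The Heisenberg group $\mathbb{H}$ is $\mathbb{R}^3$ with the group law $(x,y,z)\cdot(x',y',z')=(x+x',\,y+y',\,z+z'+\tfrac12(xy'-yx'))$. It is equipped with the metric $d(p,q)=\|q^{-1}\cdot p\|$, where $\|(x,y,z)\|=((x^2+y^2)^2+z^2)^{1/4}$ is the Koranyi norm. $B(p,r)$ denotes the open ball for $d$ and $\mathcal{H}^1$ the $1$-dimensional Hausdorff measure with respect to $d$; $L^2(E):=L^2(\mathcal{H}^1|_E)$. For $p\in\mathbb{H}$, $p^{-1}E=\{p^{-1}\cdot q:q\in E\}$. A Borel set $E\subset\mathbb{H}$ is $1$-Ahlfors regular if there is $C>0$ such that $C^{-1}r\le\mathcal{H}^1(B(p,r)\cap E)\le Cr$ for all $p\in E$ and all $0<r\le\operatorname{diam}(E)$ (with $r<\infty$). A set $E\subset\mathbb{H}$ is purely $1$-unrectifiable if $\mathcal{H}^1(E\cap f(\mathbb{R}))=0$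 for every Lipschitz function $f:\mathbb{R}\to(\mathbb{H},d)$. The kernel $K_b:\mathbb{H}\setminus\{0\}\to[0,\infty)$ is $K_b(x,y,z)=\dfrac{|x|}{\|(x,y,z)\|^{2}}$. *)

theory Defs
  imports "HOL-Analysis.Analysis"
begin

section \<open>The Heisenberg group with the Koranyi metric\<close>

datatype heis = Heis (hx: real) (hy: real) (hz: real)

text \<open>
  The group law is written additively, since \<^class>\<open>group_add\<close> is the library's class of
  not necessarily commutative groups: \<open>p + q\<close> is the product \<open>p \<cdot> q\<close>, \<open>- p\<close> is
  \<open>p\<inverse>\<close>, and \<open>- p + q\<close> is \<open>p\<inverse> \<cdot> q\<close>.
\<close>

instantiation heis :: group_add
begin

definition zero_heis :: heis where
  "0 = Heis 0 0 0"

definition plus_heis :: "heis \<Rightarrow> heis \<Rightarrow> heis" where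
  "p + q = Heis (hx p + hx q) (hy p + hy q) (hz p + hz q + (hx p * hy q - hy p * hx q) / 2)"

definition uminus_heis :: "heis \<Rightarrow> heis" where
  "- p = Heis (- hx p) (- hy p) (- hz p)"

definition minus_heis :: "heis \<Rightarrow> heis \<Rightarrow> heis" where
  "p - q = p + (- q)" for p q :: heis

instance
  by standard (auto simp: zero_heis_def plus_heis_def uminus_heis_def minus_heis_def field_simps)

end

definition koranyi :: "heis \<Rightarrow> real" where
  "koranyi p = root 4 (((hx p)\<^sup>2 + (hy p)\<^sup>2)\<^sup>2 + (hz p)\<^sup>2)"

lemma koranyi_nonneg [simp]: "0 \<le> koranyi p"
  by (simp add: koranyi_def)

lemma koranyi_uminus [simp]: "koranyi (- p) = koranyi p"
  by (simp add: koranyi_def uminus_heis_def)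

lemma koranyi_eq_0_iff [simp]: "koranyi p = 0 \<longleftrightarrow> p = 0"
  by (cases p) (auto simp: koranyi_def zero_heis_def sum_power2_eq_zero_iff add_nonneg_eq_0_iff)

lemma koranyi_sq: "(koranyi p)\<^sup>2 = cmod (Complex ((hx p)\<^sup>2 + (hy p)\<^sup>2) (hz p))"
proof -
  let ?t = "((hx p)\<^sup>2 + (hy p)\<^sup>2)\<^sup>2 + (hz p)\<^sup>2"
  have "((koranyi p)\<^sup>2)\<^sup>2 = root 4 ?t ^ 4"
    by (simp add: koranyi_def flip: power_mult)
  also have "\<dots> = ?t"
    by (rule real_root_pow_pos2) auto
  finally have "(koranyi p)\<^sup>2 = sqrt ?t"
    by (metis real_sqrt_unique zero_le_power2)
  then show ?thesis by (simp add: cmod_def)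
qed

lemma koranyi_triangle: "koranyi (p + q) \<le> koranyi p + koranyi q"
proof -
  obtain a b c where p: "p = Heis a b c" by (cases p)
  obtain x y z where q: "q = Heis x y z" by (cases q)
  let ?M = "sqrt (a\<^sup>2 + b\<^sup>2)" and ?N = "sqrt (x\<^sup>2 + y\<^sup>2)"
  have M: "?M \<le> koranyi p"
  proof (rule power2_le_imp_le)
    have "a\<^sup>2 + b\<^sup>2 \<le> cmod (Complex (a\<^sup>2 + b\<^sup>2) c)"
      using complex_Re_le_cmod[of "Complex (a\<^sup>2 + b\<^sup>2) c"] by simp
    then show "?M\<^sup>2 \<le> (koranyi p)\<^sup>2" by (simp add: koranyi_sq p)
  qed simp
  have N: "?N \<le> koranyi q"
  proof (rule power2_le_imp_le)
    have "x\<^sup>2 + y\<^sup>2 \<le> cmod (Complex (x\<^sup>2 + y\<^sup>2) z)"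
      using complex_Re_le_cmod[of "Complex (x\<^sup>2 + y\<^sup>2) z"] by simp
    then show "?N\<^sup>2 \<le> (koranyi q)\<^sup>2" by (simp add: koranyi_sq q)
  qed simp
  have "cmod (Complex (2 * (a*x + b*y)) ((a*y - b*x) / 2)) \<le> 2 * (?M * ?N)"
  proof -
    have "(2 * (a*x + b*y))\<^sup>2 + ((a*y - b*x) / 2)\<^sup>2
        = 4 * ((a\<^sup>2 + b\<^sup>2) * (x\<^sup>2 + y\<^sup>2)) - 15 * ((a*y - b*x) / 2)\<^sup>2"
      by (simp add: power2_eq_square field_simps)
    also have "\<dots> \<le> 4 * ((a\<^sup>2 + b\<^sup>2) * (x\<^sup>2 + y\<^sup>2))"
      by simp
    also have "\<dots> = (2 * (?M * ?N))\<^sup>2"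
      by (simp add: power_mult_distrib)
    finally show ?thesis
      by (simp add: cmod_def real_le_lsqrt)
  qed
  also have "\<dots> \<le> 2 * (koranyi p * koranyi q)"
    using M N by (intro mult_left_mono mult_mono) auto
  finally have cross: "cmod (Complex (2 * (a*x + b*y)) ((a*y - b*x) / 2)) \<le> 2 * (koranyi p * koranyi q)" .
  have "(koranyi (p + q))\<^sup>2
      = cmod (Complex (a\<^sup>2 + b\<^sup>2) c + Complex (x\<^sup>2 + y\<^sup>2) z
              + Complex (2 * (a*x + b*y)) ((a*y - b*x) / 2))"
    unfolding koranyi_sq
    by (rule arg_cong[where f = cmod])
       (simp add: p q plus_heis_def complex_eq_iff power2_eq_square field_simps)
  also have "\<dots> \<le> cmod (Complex (a\<^sup>2 + b\<^sup>2) c) + cmod (Complex (x\<^sup>2 + y\<^sup>2) z)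
              + cmod (Complex (2 * (a*x + b*y)) ((a*y - b*x) / 2))"
    by (intro norm_triangle_le add_mono order.refl norm_triangle_ineq)
  also have "\<dots> \<le> (koranyi p)\<^sup>2 + (koranyi q)\<^sup>2 + 2 * (koranyi p * koranyi q)"
    using cross by (simp add: koranyi_sq p q)
  also have "\<dots> = (koranyi p + koranyi q)\<^sup>2"
    by (simp add: power2_sum)
  finally show ?thesis
    by (rule power2_le_imp_le) simp
qed

instantiation heis :: metric_space
begin

definition dist_heis :: "heis \<Rightarrow> heis \<Rightarrow> real" where
  "dist p q = koranyi (- q + p)"

definition uniformity_heis :: "(heis \<times> heis) filter" where
  "uniformity_heis = (INF e\<in>{0<..}. principal {(x, y). dist x y < e})"

definition open_heis :: "heis set \<Rightarrow> bool" where
  "open_heis U \<longleftrightarrow> (\<forall>x\<in>U. \<forall>\<^sub>F (x', y) in uniformity. x' = x \<longrightarrow> y \<in> U)"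

instance
proof
  fix p q r :: heis
  have "- q + p = 0 \<longleftrightarrow> p = q"
    using neg_eq_iff_add_eq_0[of "- q" p] by auto
  then show "dist p q = 0 \<longleftrightarrow> p = q"
    by (simp add: dist_heis_def)
  have "koranyi (- q + p) = koranyi ((- q + r) + (- r + p))"
    by (simp only: add.assoc add_minus_cancel)
  also have "\<dots> \<le> koranyi (- q + r) + koranyi (- r + p)"
    by (rule koranyi_triangle)
  also have "koranyi (- q + r) = koranyi (- (- q + r))"
    by (rule koranyi_uminus[symmetric])
  also have "- (- q + r) = - r + q"
    by (simp only: minus_add minus_minus)
  finally show "dist p q \<le> dist p r + dist q r"
    by (simp add: dist_heis_def)
qed (simp_all add: uniformity_heis_def open_heis_def)

end


section \<open>The one-dimensional Hausdorff measure of a metric space\<close>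

text \<open>
  The library's \<^const>\<open>diameter\<close> is real-valued and therefore meaningless on unbounded sets,
  whence the extended version.
\<close>

definition ediam :: "'a::metric_space set \<Rightarrow> ennreal" where
  "ediam A = (SUP x\<in>A. SUP y\<in>A. ennreal (dist x y))"

definition hausdorff1_pre :: "real \<Rightarrow> 'a::metric_space set \<Rightarrow> ennreal" where
  "hausdorff1_pre \<delta> A =
     (INF U\<in>{U :: nat \<Rightarrow> 'a set. A \<subseteq> (\<Union>n. U n) \<and> (\<forall>n. ediam (U n) \<le> ennreal \<delta>)}. \<Sum>n. ediam (U n))"

definition hausdorff1_outer :: "'a::metric_space set \<Rightarrow> ennreal" where
  "hausdorff1_outer A = (SUP \<delta>\<in>{0<..}. hausdorff1_pre \<delta> A)"

definition hausdorff1 :: "'a::metric_space measure" where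
  "hausdorff1 = measure_of UNIV (sets borel) hausdorff1_outer"

text \<open>
  \<^const>\<open>measure_of\<close> yields the zero measure unless it is given a countably additive function.
  The following lemmas show that the outer measure is additive on Borel sets,
  so that \<^const>\<open>hausdorff1\<close> is indeed its restriction to them.
\<close>

lemma ediam_empty [simp]: "ediam {} = 0"
  by (simp add: ediam_def bot_ennreal)

lemma ediam_mono: "A \<subseteq> B \<Longrightarrow> ediam A \<le> ediam B"
  unfolding ediam_def by (meson SUP_subset_mono order.refl)

lemma ediam_upper: "x \<in> A \<Longrightarrow> y \<in> A \<Longrightarrow> ennreal (dist x y) \<le> ediam A"
  unfolding ediam_def by (meson SUP_upper2 order.refl)

lemma hausdorff1_pre_empty [simp]: "hausdorff1_pre \<delta> {} = 0"
proof -
  have "hausdorff1_pre \<delta> ({} :: 'a set) \<le> (\<Sum>n::nat. ediam ({} :: 'a set))"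
    unfolding hausdorff1_pre_def by (rule INF_lower) auto
  then show ?thesis by simp
qed

lemma hausdorff1_pre_mono: "A \<subseteq> B \<Longrightarrow> hausdorff1_pre \<delta> A \<le> hausdorff1_pre \<delta> B"
  unfolding hausdorff1_pre_def by (rule INF_superset_mono) auto

lemma hausdorff1_pre_antimono: "\<delta> \<le> \<epsilon> \<Longrightarrow> hausdorff1_pre \<epsilon> A \<le> hausdorff1_pre \<delta> A"
  unfolding hausdorff1_pre_def
  by (rule INF_superset_mono) (auto intro: order.trans ennreal_leI)

lemma hausdorff1_pre_subadd:
  fixes A :: "nat \<Rightarrow> 'a::metric_space set"
  shows "hausdorff1_pre \<delta> (\<Union>i. A i) \<le> (\<Sum>i. hausdorff1_pre \<delta> (A i))"
proof (cases "(\<Sum>i. hausdorff1_pre \<delta> (A i)) = top")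
  case False
  then have fin: "hausdorff1_pre \<delta> (A i) < top" for i
    using ennreal_suminf_lessD less_top by blast
  show ?thesis
  proof (rule ennreal_le_epsilon)
    fix e :: real assume e: "0 < e"
    have "\<exists>U :: nat \<Rightarrow> 'a set. A i \<subseteq> (\<Union>n. U n) \<and> (\<forall>n. ediam (U n) \<le> ennreal \<delta>)
        \<and> (\<Sum>n. ediam (U n)) \<le> hausdorff1_pre \<delta> (A i) + ennreal (e * (1/2) ^ Suc i)" for i
    proof -
      have pos: "0 < ennreal (e * (1/2) ^ Suc i)"
        using e by simp
      have "hausdorff1_pre \<delta> (A i) < hausdorff1_pre \<delta> (A i) + ennreal (e * (1/2) ^ Suc i)"
        using fin[of i] pos by (metis add.right_neutral ennreal_add_left_cancel_less infinity_ennreal_def)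
      then show ?thesis
        unfolding hausdorff1_pre_def[of \<delta> "A i"] INF_less_iff by (auto intro: less_imp_le)
    qed
    then obtain U where U: "\<And>i. A i \<subseteq> (\<Union>n. U i n)" "\<And>i n. ediam (U i n) \<le> ennreal \<delta>"
      "\<And>i. (\<Sum>n. ediam (U i n)) \<le> hausdorff1_pre \<delta> (A i) + ennreal (e * (1/2) ^ Suc i)"
      by metis
    let ?V = "\<lambda>k. case prod_decode k of (i, n) \<Rightarrow> U i n"
    have cover: "(\<Union>i. A i) \<subseteq> (\<Union>k. ?V k)"
    proof
      fix x assume "x \<in> (\<Union>i. A i)"
      then obtain i n where "x \<in> U i n" using U(1) by blast
      then have "x \<in> ?V (prod_encode (i, n))" by simp
      then show "x \<in> (\<Union>k. ?V k)" by (rule UN_I[OF UNIV_I])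
    qed
    have "hausdorff1_pre \<delta> (\<Union>i. A i) \<le> (\<Sum>k. ediam (?V k))"
      unfolding hausdorff1_pre_def
      by (rule INF_lower) (use cover U(2) in \<open>auto split: prod.split\<close>)
    also have "\<dots> = (\<Sum>k. (\<lambda>(i, n). ediam (U i n)) (prod_decode k))"
      by (rule suminf_cong) (simp split: prod.split)
    also have "\<dots> = (\<Sum>i. \<Sum>n. ediam (U i n))"
      by (rule suminf_ennreal_2dimen) simp
    also have "\<dots> \<le> (\<Sum>i. hausdorff1_pre \<delta> (A i) + ennreal (e * (1/2) ^ Suc i))"
      by (intro suminf_le U(3)) auto
    also have "\<dots> = (\<Sum>i. hausdorff1_pre \<delta> (A i)) + (\<Sum>i. ennreal (e * (1/2) ^ Suc i))"
      by (rule suminf_add[symmetric]) auto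
    also have "(\<Sum>i. ennreal (e * (1/2) ^ Suc i)) = ennreal e"
    proof (rule suminf_ennreal_eq)
      show "(\<lambda>i. e * (1/2) ^ Suc i) sums e"
        using sums_mult[OF power_half_series, of e] by simp
    qed (use e in auto)
    finally show "hausdorff1_pre \<delta> (\<Union>i. A i) \<le> (\<Sum>i. hausdorff1_pre \<delta> (A i)) + ennreal e" .
  qed
qed simp

lemma hausdorff1_outer_empty [simp]: "hausdorff1_outer {} = 0"
  by (simp add: hausdorff1_outer_def)

lemma hausdorff1_outer_mono: "A \<subseteq> B \<Longrightarrow> hausdorff1_outer A \<le> hausdorff1_outer B"
  unfolding hausdorff1_outer_def by (intro SUP_mono' hausdorff1_pre_mono)

lemma hausdorff1_outer_subadd: "hausdorff1_outer (\<Union>i. A i) \<le> (\<Sum>i. hausdorff1_outer (A i))"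
  unfolding hausdorff1_outer_def[of "\<Union>i. A i"]
proof (rule SUP_least)
  fix \<delta> :: real assume "\<delta> \<in> {0<..}"
  then have "(\<Sum>i. hausdorff1_pre \<delta> (A i)) \<le> (\<Sum>i. hausdorff1_outer (A i))"
    unfolding hausdorff1_outer_def by (intro suminf_le SUP_upper) auto
  then show "hausdorff1_pre \<delta> (\<Union>i. A i) \<le> (\<Sum>i. hausdorff1_outer (A i))"
    using hausdorff1_pre_subadd order.trans by blast
qed

lemma hausdorff1_outer_subadd2: "hausdorff1_outer (A \<union> B) \<le> hausdorff1_outer A + hausdorff1_outer B"
proof -
  have "hausdorff1_outer (A \<union> B) = hausdorff1_outer (\<Union>i. binaryset A B i)"
    by (simp add: UN_binaryset_eq)
  also have "\<dots> \<le> (\<Sum>i. hausdorff1_outer (binaryset A B i))"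
    by (rule hausdorff1_outer_subadd)
  also have "\<dots> = hausdorff1_outer A + hausdorff1_outer B"
    by (rule suminf_binaryset_eq) simp
  finally show ?thesis .
qed

lemma hausdorff1_pre_separated:
  assumes "\<And>x y. x \<in> A \<Longrightarrow> y \<in> B \<Longrightarrow> e \<le> dist x y" and "\<delta> < e" "0 < e"
  shows "hausdorff1_pre \<delta> A + hausdorff1_pre \<delta> B \<le> hausdorff1_pre \<delta> (A \<union> B)"
  unfolding hausdorff1_pre_def[of \<delta> "A \<union> B"]
proof (rule INF_greatest, clarify)
  fix U :: "nat \<Rightarrow> 'a set"
  assume U: "A \<union> B \<subseteq> (\<Union>n. U n)" "\<forall>n. ediam (U n) \<le> ennreal \<delta>"
  have "hausdorff1_pre \<delta> A \<le> (\<Sum>n. ediam (U n \<inter> A))"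
    unfolding hausdorff1_pre_def
    by (rule INF_lower) (use U in \<open>auto intro: order.trans[OF ediam_mono]\<close>)
  moreover have "hausdorff1_pre \<delta> B \<le> (\<Sum>n. ediam (U n \<inter> B))"
    unfolding hausdorff1_pre_def
    by (rule INF_lower) (use U in \<open>auto intro: order.trans[OF ediam_mono]\<close>)
  ultimately have "hausdorff1_pre \<delta> A + hausdorff1_pre \<delta> B
      \<le> (\<Sum>n. ediam (U n \<inter> A)) + (\<Sum>n. ediam (U n \<inter> B))"
    by (rule add_mono)
  also have "\<dots> = (\<Sum>n. ediam (U n \<inter> A) + ediam (U n \<inter> B))"
    by (rule suminf_add) auto
  also have "\<dots> \<le> (\<Sum>n. ediam (U n))"
  proof (rule suminf_le)
    fix n
    have "U n \<inter> A = {} \<or> U n \<inter> B = {}"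
    proof (rule ccontr)
      assume "\<not> ?thesis"
      then obtain x y where xy: "x \<in> U n" "x \<in> A" "y \<in> U n" "y \<in> B" by blast
      then have "ennreal (dist x y) \<le> ennreal \<delta>"
        using U(2) ediam_upper order.trans by blast
      moreover have "e \<le> dist x y" using assms(1) xy by blast
      ultimately show False
        using assms(2,3) by (auto simp: ennreal_le_iff2)
    qed
    then show "ediam (U n \<inter> A) + ediam (U n \<inter> B) \<le> ediam (U n)"
      by (auto intro: ediam_mono)
  qed auto
  finally show "hausdorff1_pre \<delta> A + hausdorff1_pre \<delta> B \<le> (\<Sum>n. ediam (U n))" .
qed

lemma hausdorff1_outer_separated:
  assumes "\<And>x y. x \<in> A \<Longrightarrow> y \<in> B \<Longrightarrow> e \<le> dist x y" and "0 < e"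
  shows "hausdorff1_outer A + hausdorff1_outer B \<le> hausdorff1_outer (A \<union> B)"
proof -
  have *: "hausdorff1_pre \<delta> A + hausdorff1_pre \<epsilon> B \<le> hausdorff1_outer (A \<union> B)"
    if "0 < \<delta>" "0 < \<epsilon>" for \<delta> \<epsilon>
  proof -
    let ?m = "min (min \<delta> \<epsilon>) (e / 2)"
    have "hausdorff1_pre \<delta> A + hausdorff1_pre \<epsilon> B \<le> hausdorff1_pre ?m A + hausdorff1_pre ?m B"
      by (intro add_mono hausdorff1_pre_antimono) auto
    also have "\<dots> \<le> hausdorff1_pre ?m (A \<union> B)"
      using assms by (intro hausdorff1_pre_separated[where e = e]) auto
    also have "\<dots> \<le> hausdorff1_outer (A \<union> B)"
      unfolding hausdorff1_outer_def using that assms(2) by (intro SUP_upper) auto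
    finally show ?thesis .
  qed
  have ne: "{0::real<..} \<noteq> {}" by (auto intro: exI[of _ 1])
  have "hausdorff1_outer A + hausdorff1_pre \<epsilon> B \<le> hausdorff1_outer (A \<union> B)" if "0 < \<epsilon>" for \<epsilon>
    unfolding hausdorff1_outer_def[of A]
    by (subst ennreal_SUP_add_left[OF ne, symmetric]) (auto intro!: SUP_least * that)
  then show ?thesis
    unfolding hausdorff1_outer_def[of B]
    by (subst ennreal_SUP_add_right[OF ne]) (auto intro!: SUP_least)
qed

lemma hausdorff1_outer_separated_sum:
  assumes sep: "\<And>i j x y. i < j \<Longrightarrow> x \<in> R i \<Longrightarrow> y \<in> R j \<Longrightarrow> e j \<le> dist x y"
    and pos: "\<And>j::nat. 0 < e j"
  shows "(\<Sum>i<n. hausdorff1_outer (R i)) \<le> hausdorff1_outer (\<Union>i<n. R i)"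
proof (induction n)
  case (Suc n)
  have "(\<Sum>i<Suc n. hausdorff1_outer (R i)) \<le> hausdorff1_outer (\<Union>i<n. R i) + hausdorff1_outer (R n)"
    using Suc by (simp add: add_mono)
  also have "\<dots> \<le> hausdorff1_outer ((\<Union>i<n. R i) \<union> R n)"
    by (rule hausdorff1_outer_separated[where e = "e n"]) (use sep pos in auto)
  also have "(\<Union>i<n. R i) \<union> R n = (\<Union>i<Suc n. R i)"
    by (auto simp: less_Suc_eq)
  finally show ?case .
qed simp

lemma hausdorff1_outer_closed:
  fixes C A :: "'a::metric_space set"
  assumes C: "closed C"
  shows "hausdorff1_outer (A \<inter> C) + hausdorff1_outer (A - C) \<le> hausdorff1_outer A"
proof (cases "hausdorff1_outer A = top \<or> C = {}")
  case False
  then have fin: "hausdorff1_outer A < top" and ne: "C \<noteq> {}" by (auto simp: less_top)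
  define a :: "nat \<Rightarrow> real" where "a n = 1 / real (Suc n)" for n
  define B where "B n = {x \<in> A. a n \<le> infdist x C}" for n
  define R where "R n = {x \<in> A. a (Suc n) \<le> infdist x C \<and> infdist x C < a n}" for n
  have a_pos: "0 < a n" for n by (simp add: a_def)
  have a_anti: "a n \<le> a m" if "m \<le> n" for m n
    using that by (simp add: a_def frac_le)
  have a_less: "a (Suc n) < a n" for n
    by (simp add: a_def frac_less2)
  have step: "hausdorff1_outer (A \<inter> C) + hausdorff1_outer (B n) \<le> hausdorff1_outer A" for n
  proof -
    have "hausdorff1_outer (A \<inter> C) + hausdorff1_outer (B n) \<le> hausdorff1_outer ((A \<inter> C) \<union> B n)"
    proof (rule hausdorff1_outer_separated[where e = "a n"])
      fix x y assume "x \<in> A \<inter> C" "y \<in> B n"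
      then show "a n \<le> dist x y"
        using infdist_le[of x C y] by (auto simp: B_def dist_commute)
    qed (rule a_pos)
    also have "\<dots> \<le> hausdorff1_outer A"
      by (rule hausdorff1_outer_mono) (auto simp: B_def)
    finally show ?thesis .
  qed
  have ndist: "a (Suc i) - a j \<le> dist x y" if "x \<in> R i" "y \<in> R j" for i j x y
    using that infdist_triangle[of x C y] by (auto simp: R_def)
  have half: "(\<Sum>i<n. hausdorff1_outer (R (2 * i + k))) \<le> hausdorff1_outer A" for k n
  proof -
    have "(\<Sum>i<n. hausdorff1_outer (R (2 * i + k))) \<le> hausdorff1_outer (\<Union>i<n. R (2 * i + k))"
    proof (rule hausdorff1_outer_separated_sum[where e = "\<lambda>j. a (2 * j + k - 1) - a (2 * j + k)
              + (if j = 0 then 1 else 0)"])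
      fix i j :: nat and x y
      assume ij: "i < j" and "x \<in> R (2 * i + k)" "y \<in> R (2 * j + k)"
      then have "a (Suc (2 * i + k)) - a (2 * j + k) \<le> dist x y"
        using ndist by blast
      moreover have "a (2 * j + k - 1) \<le> a (Suc (2 * i + k))"
        using ij by (intro a_anti) auto
      ultimately show "a (2 * j + k - 1) - a (2 * j + k) + (if j = 0 then 1 else 0) \<le> dist x y"
        using ij by auto
    next
      fix j :: nat
      show "0 < a (2 * j + k - 1) - a (2 * j + k) + (if j = 0 then 1 else 0)"
      proof (cases "j = 0")
        case True
        then show ?thesis using a_anti[of "k - 1" k] by simp
      next
        case False
        then show ?thesis using a_less[of "2 * j + k - 1"] by simp
      qed
    qed
    also have "\<dots> \<le> hausdorff1_outer A"
      by (rule hausdorff1_outer_mono) (auto simp: R_def)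
    finally show ?thesis .
  qed
  have sum_fin: "(\<Sum>i. hausdorff1_outer (R i)) < top"
  proof -
    have "(\<Sum>i<n. hausdorff1_outer (R i)) \<le> hausdorff1_outer A + hausdorff1_outer A" for n
    proof -
      have "(\<Sum>i<n. hausdorff1_outer (R i)) \<le> (\<Sum>i<2 * n. hausdorff1_outer (R i))"
        by (rule sum_mono2) auto
      also have "\<dots> = (\<Sum>i<n. hausdorff1_outer (R (2 * i + 0))) + (\<Sum>i<n. hausdorff1_outer (R (2 * i + 1)))"
        by (induction n) (auto simp: algebra_simps)
      also have "\<dots> \<le> hausdorff1_outer A + hausdorff1_outer A"
        by (intro add_mono half)
      finally show ?thesis .
    qed
    then have "(\<Sum>i. hausdorff1_outer (R i)) \<le> hausdorff1_outer A + hausdorff1_outer A"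
      by (intro suminf_le_const) auto
    also have "\<dots> < top" using fin by simp
    finally show ?thesis .
  qed
  have tail: "hausdorff1_outer (A - C) \<le> hausdorff1_outer (B n) + (\<Sum>i. hausdorff1_outer (R (i + n)))" for n
  proof -
    have "A - C \<subseteq> B n \<union> (\<Union>i. R (i + n))"
    proof
      fix x assume x: "x \<in> A - C"
      then have d: "0 < infdist x C"
        using in_closed_iff_infdist_zero[OF C ne, of x] infdist_nonneg[of x C] by auto
      show "x \<in> B n \<union> (\<Union>i. R (i + n))"
      proof (cases "x \<in> B n")
        case False
        obtain m where m: "a m < infdist x C"
          using reals_Archimedean[OF d] by (auto simp: a_def inverse_eq_divide)
        define k where "k = (LEAST m. a m \<le> infdist x C)"
        have k: "a k \<le> infdist x C"
          unfolding k_def by (rule LeastI[of _ m]) (use m in auto)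
        have "n < k"
        proof (rule ccontr)
          assume "\<not> n < k"
          then have "a n \<le> infdist x C" using a_anti[of k n] k by auto
          then show False using False x by (auto simp: B_def)
        qed
        then obtain i where i: "k = Suc (i + n)"
          by (metis add.commute less_imp_Suc_add)
        have "\<not> a (i + n) \<le> infdist x C"
          using not_less_Least[of "i + n" "\<lambda>m. a m \<le> infdist x C"] i by (auto simp: k_def)
        then have "x \<in> R (i + n)" using k i x by (auto simp: R_def)
        then show ?thesis by blast
      qed simp
    qed
    then have "hausdorff1_outer (A - C) \<le> hausdorff1_outer (B n \<union> (\<Union>i. R (i + n)))"
      by (rule hausdorff1_outer_mono)
    also have "\<dots> \<le> hausdorff1_outer (B n) + hausdorff1_outer (\<Union>i. R (i + n))"
      by (rule hausdorff1_outer_subadd2)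
    also have "\<dots> \<le> hausdorff1_outer (B n) + (\<Sum>i. hausdorff1_outer (R (i + n)))"
      by (intro add_mono order.refl hausdorff1_outer_subadd)
    finally show ?thesis .
  qed
  have "hausdorff1_outer (A \<inter> C) + hausdorff1_outer (A - C)
      \<le> hausdorff1_outer A + (\<Sum>i. hausdorff1_outer (R (i + n)))" for n
  proof -
    have "hausdorff1_outer (A \<inter> C) + hausdorff1_outer (A - C)
        \<le> (hausdorff1_outer (A \<inter> C) + hausdorff1_outer (B n)) + (\<Sum>i. hausdorff1_outer (R (i + n)))"
      using tail[of n] by (simp add: add.assoc add_left_mono)
    also have "\<dots> \<le> hausdorff1_outer A + (\<Sum>i. hausdorff1_outer (R (i + n)))"
      by (intro add_right_mono step)
    finally show ?thesis .
  qed
  moreover have "(\<lambda>n. hausdorff1_outer A + (\<Sum>i. hausdorff1_outer (R (i + n)))) \<longlonglongrightarrow> hausdorff1_outer A + 0"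
  proof (intro tendsto_add tendsto_const)
    have summ: "summable (\<lambda>i. enn2real (hausdorff1_outer (R i)))"
      and eq: "\<And>i. hausdorff1_outer (R i) = ennreal (enn2real (hausdorff1_outer (R i)))"
    proof -
      show eq: "hausdorff1_outer (R i) = ennreal (enn2real (hausdorff1_outer (R i)))" for i
        using ennreal_suminf_lessD[OF sum_fin, of i] by simp
      have "(\<Sum>i. ennreal (enn2real (hausdorff1_outer (R i)))) \<noteq> top"
        using sum_fin eq by simp
      then show "summable (\<lambda>i. enn2real (hausdorff1_outer (R i)))"
        by (intro summable_suminf_not_top) auto
    qed
    have "(\<Sum>i. hausdorff1_outer (R (i + n))) = ennreal (\<Sum>i. enn2real (hausdorff1_outer (R (i + n))))" for n
      by (subst eq) (intro suminf_ennreal2 summable_ignore_initial_segment summ, simp)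
    moreover have "(\<lambda>n. ennreal (\<Sum>i. enn2real (hausdorff1_outer (R (i + n))))) \<longlonglongrightarrow> ennreal 0"
      by (intro tendsto_ennrealI suminf_exist_split2 summ)
    ultimately show "(\<lambda>n. \<Sum>i. hausdorff1_outer (R (i + n))) \<longlonglongrightarrow> 0" by simp
  qed
  ultimately show ?thesis
    by (auto intro!: LIMSEQ_le_const)
qed auto

lemma measure_space_hausdorff1: "measure_space UNIV (sets borel) (hausdorff1_outer :: 'a::metric_space set \<Rightarrow> ennreal)"
proof -
  let ?L = "lambda_system UNIV UNIV (hausdorff1_outer :: 'a set \<Rightarrow> ennreal)"
  interpret P: sigma_algebra UNIV "UNIV :: 'a set set"
    using sigma_algebra_Pow[of "UNIV :: 'a set"] by simp
  have "outer_measure_space UNIV (hausdorff1_outer :: 'a set \<Rightarrow> ennreal)"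
    by (auto simp: outer_measure_space_def positive_def increasing_def countably_subadditive_def
        intro: hausdorff1_outer_mono hausdorff1_outer_subadd)
  then have M: "measure_space UNIV ?L hausdorff1_outer"
    by (rule P.caratheodory_lemma)
  have "C \<in> ?L" if "closed C" for C
  proof -
    have "hausdorff1_outer (A \<inter> C) + hausdorff1_outer (A - C) = hausdorff1_outer A" for A
    proof (rule antisym[OF hausdorff1_outer_closed[OF that]])
      have "(A \<inter> C) \<union> (A - C) = A" by blast
      then show "hausdorff1_outer A \<le> hausdorff1_outer (A \<inter> C) + hausdorff1_outer (A - C)"
        using hausdorff1_outer_subadd2[of "A \<inter> C" "A - C"] by simp
    qed
    then show ?thesis by (simp add: P.lambda_system_eq)
  qed
  then have "sigma_sets UNIV (Collect closed) \<subseteq> ?L"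
    using M unfolding measure_space_def by (intro sigma_algebra.sigma_sets_subset) auto
  then have "sets borel \<subseteq> ?L"
    by (simp add: borel_eq_closed)
  moreover have "sigma_algebra UNIV (sets (borel :: 'a measure))"
    using sets.sigma_algebra_axioms[of "borel :: 'a measure"] by simp
  ultimately show ?thesis
    using measure_down[OF M] by blast
qed

lemma space_hausdorff1 [simp]: "space hausdorff1 = UNIV"
  unfolding hausdorff1_def by (rule space_measure_of) simp

lemma sets_hausdorff1 [simp, measurable_cong]: "sets (hausdorff1 :: 'a::metric_space measure) = sets borel"
  using sets.sigma_sets_eq[of "borel :: 'a measure"]
  by (simp add: hausdorff1_def sets_measure_of)

lemma emeasure_hausdorff1: "A \<in> sets borel \<Longrightarrow> emeasure hausdorff1 A = hausdorff1_outer A"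
  unfolding hausdorff1_def
  using measure_space_hausdorff1 sets.sigma_sets_eq[of "borel :: 'a measure"]
  by (subst emeasure_measure_of_sigma)
     (auto simp: measure_space_def)


section \<open>Regularity and unrectifiability\<close>

text \<open>
  An Ahlfors regular set is understood to have positive diameter: the two-sided estimate is
  vacuous for the empty set and for singletons.
\<close>

definition ahlfors_regular1 :: "'a::metric_space set \<Rightarrow> bool" where
  "ahlfors_regular1 E \<longleftrightarrow>
     E \<in> sets borel \<and> 0 < ediam E \<and>
     (\<exists>C::real>0. \<forall>p\<in>E. \<forall>r::real. 0 < r \<and> ennreal r \<le> ediam E \<longrightarrow>
        ennreal (r / C) \<le> emeasure hausdorff1 (ball p r \<inter> E) \<and>
        emeasure hausdorff1 (ball p r \<inter> E) \<le> ennreal (C * r))"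

text \<open>
  The outer measure is used because \<^const>\<open>emeasure\<close> is \<open>0\<close> on non-measurable sets,
  and \<open>E\<close> is not required to be a Borel set here.
\<close>

definition purely_unrectifiable1 :: "'a::metric_space set \<Rightarrow> bool" where
  "purely_unrectifiable1 E \<longleftrightarrow>
     (\<forall>f :: real \<Rightarrow> 'a. (\<exists>L. L-lipschitz_on UNIV f) \<longrightarrow> hausdorff1_outer (E \<inter> range f) = 0)"


section \<open>Square-integrable functions and truncated singular integrals\<close>

definition L2 :: "'a measure \<Rightarrow> ('a \<Rightarrow> real) set" where
  "L2 M = {f \<in> borel_measurable M. integrable M (\<lambda>x. (f x)\<^sup>2)}"

definition L2_norm :: "'a measure \<Rightarrow> ('a \<Rightarrow> real) \<Rightarrow> real" where
  "L2_norm M f = sqrt (LINT x|M. (f x)\<^sup>2)"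

definition K_b :: "heis \<Rightarrow> real" where
  "K_b v = \<bar>hx v\<bar> / (koranyi v)\<^sup>2"

definition truncated_sio :: "(heis \<Rightarrow> real) \<Rightarrow> heis set \<Rightarrow> real \<Rightarrow> (heis \<Rightarrow> real) \<Rightarrow> heis \<Rightarrow> real" where
  "truncated_sio K E \<epsilon> f p = (LINT q:(E - ball p \<epsilon>)|hausdorff1. K (- p + q) * f q)"

text \<open>
  Membership of the truncated integral in \<open>L\<^sup>2(E)\<close> is stated explicitly: without it, the
  real-valued norm of a function that is not square-integrable would be \<open>0\<close>.
\<close>

definition sio_bounded_L2 :: "(heis \<Rightarrow> real) \<Rightarrow> heis set \<Rightarrow> bool" where
  "sio_bounded_L2 K E \<longleftrightarrow>
     (\<exists>C::real>0. \<forall>f \<in> L2 (restrict_space hausdorff1 E). \<forall>\<epsilon>::real>0.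
        truncated_sio K E \<epsilon> f \<in> L2 (restrict_space hausdorff1 E) \<and>
        L2_norm (restrict_space hausdorff1 E) (truncated_sio K E \<epsilon> f)
          \<le> C * L2_norm (restrict_space hausdorff1 E) f)"

end

theory Submission
  imports Defs
begin

text \<open>
  The kernel \<open>K\<^sub>b\<close> is small compared with \<open>1 / \<parallel>\<cdot>\<parallel>\<close> near the vertical direction, because along the
  \<open>z\<close>-axis the Koranyi norm is the square root of the Euclidean one.  Take \<open>E\<close> on the diagonal
  \<open>{(t, 0, t)}\<close>.  On that line the twist \<open>(xy' - yx') / 2\<close> of the group law vanishes, so for two
  points with parameter difference \<open>u\<close> the distance is \<open>(u\<^sup>4 + u\<^sup>2)\<^bsup>1/4\<^esup>\<close>, comparable to
  \<open>\<bar>u\<bar>\<^bsup>1/2\<^esup>\<close> for bounded \<open>u\<close>, while the kernel is \<open>\<bar>u\<bar> / (u\<^sup>4 + u\<^sup>2)\<^bsup>1/2\<^esup> \<le> 1\<close> and vanishes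
  for no \<open>u \<noteq> 0\<close>.  Hence the kernel is bounded on \<open>E\<close>, and as soon as \<open>E\<close> has finite measure the
  Cauchy--Schwarz inequality makes all truncations uniformly bounded on \<open>L\<^sup>2(E)\<close>
  (\<open>sio_bounded_L2_of_bounded_kernel\<close>).

  It remains to choose the parameters so that \<open>E\<close> is regular and unrectifiable.  Let \<open>t\<close> run over the
  sums of distinct powers \<open>4\<^sup>-\<^sup>i\<close>, a Cantor set of Euclidean dimension \<open>1/2\<close>.  Two of them whose
  digits first differ at place \<open>n\<close> are at Euclidean distance about \<open>4\<^sup>-\<^sup>n\<close>, so the corresponding
  points of \<open>E\<close> are at distance about \<open>2\<^sup>-\<^sup>n\<close>.  This property alone gives the rest, in every
  metric space (locale \<open>cantor_tree\<close>): such a set consists of \<open>2\<^sup>n\<close> pieces of diameter about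
  \<open>2\<^sup>-\<^sup>n\<close>, which bounds its measure from above, and reading binary digits maps \<open>[0, 1)\<close> into it
  without contracting distances by more than a constant, which bounds its measure from below.

  The pieces of one level are moreover separated by a multiple of \<open>2\<^sup>-\<^sup>n\<close>.  A Lipschitz
  curve loses time proportional to \<open>2\<^sup>-\<^sup>n\<close> in jumping between them, at every level anew.  In bounded
  time it thus cannot visit a positive proportion of the pieces at infinitely many levels
  (\<open>nested_separated_packing\<close>), and so it meets \<open>E\<close> in a null set only
  (\<open>purely_unrectifiable_range\<close>).
\<close>


section \<open>Estimating Hausdorff measure in a metric space\<close>

lemma hausdorff1_pre_finite_cover:
  assumes fin: "finite I" and cover: "A \<subseteq> (\<Union>i\<in>I. U i)"
    and diam: "\<And>i. i \<in> I \<Longrightarrow> ediam (U i) \<le> ennreal d" and "d \<le> \<delta>"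
  shows "hausdorff1_pre \<delta> A \<le> of_nat (card I) * ennreal d"
proof -
  obtain h where h: "bij_betw h {..<card I} I"
    using ex_bij_betw_nat_finite[OF fin] by (auto simp: lessThan_atLeast0)
  define V where "V n = (if n < card I then U (h n) else {})" for n
  have hI: "h n \<in> I" if "n < card I" for n
    using h that by (auto simp: bij_betw_def)
  have "A \<subseteq> (\<Union>n. V n)"
  proof
    fix x assume "x \<in> A"
    then obtain i where i: "i \<in> I" "x \<in> U i" using cover by blast
    then obtain n where "n < card I" "i = h n" using h by (auto simp: bij_betw_def)
    then have "x \<in> V n" using i by (simp add: V_def)
    then show "x \<in> (\<Union>n. V n)" by blast
  qed
  moreover have "ediam (V n) \<le> ennreal \<delta>" for n
    using diam[OF hI, of n] \<open>d \<le> \<delta>\<close> by (auto simp: V_def intro: order.trans ennreal_leI)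
  ultimately have "hausdorff1_pre \<delta> A \<le> (\<Sum>n. ediam (V n))"
    unfolding hausdorff1_pre_def by (intro INF_lower) auto
  also have "\<dots> = (\<Sum>n<card I. ediam (V n))"
    by (rule suminf_finite) (auto simp: V_def)
  also have "\<dots> \<le> (\<Sum>n<card I. ennreal d)"
    using diam hI by (intro sum_mono) (auto simp: V_def)
  finally show ?thesis by simp
qed

lemma hausdorff1_outer_le_of_covers:
  assumes "\<And>k::nat. finite (I k)" and "\<And>k. A \<subseteq> (\<Union>i\<in>I k. U k i)"
    and "\<And>k i. i \<in> I k \<Longrightarrow> ediam (U k i) \<le> ennreal (d k)"
    and d: "\<And>k. 0 \<le> d k" "d \<longlonglongrightarrow> 0"
    and lim: "(\<lambda>k. real (card (I k)) * d k) \<longlonglongrightarrow> B"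
  shows "hausdorff1_outer A \<le> ennreal B"
  unfolding hausdorff1_outer_def
proof (rule SUP_least)
  fix \<delta> :: real assume "\<delta> \<in> {0<..}"
  then have "\<forall>\<^sub>F k in sequentially. d k < \<delta>"
    using order_tendstoD(2)[OF d(2)] by auto
  then have "\<forall>\<^sub>F k in sequentially. hausdorff1_pre \<delta> A \<le> ennreal (real (card (I k)) * d k)"
  proof eventually_elim
    case (elim k)
    have "hausdorff1_pre \<delta> A \<le> of_nat (card (I k)) * ennreal (d k)"
      using elim assms(1-3) by (intro hausdorff1_pre_finite_cover[where U = "U k"]) auto
    then show ?case using d(1)[of k] by (simp add: ennreal_mult ennreal_of_nat_eq_real_of_nat)
  qed
  then show "hausdorff1_pre \<delta> A \<le> ennreal B"
    by (intro tendsto_lowerbound[OF tendsto_ennrealI[OF lim]]) auto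
qed

text \<open>
  An expanding map from the line transports a lower bound from Lebesgue to Hausdorff measure:
  a covering of its image by sets of small diameter pulls back to a covering by sets that lie in
  short intervals.
\<close>

lemma hausdorff1_outer_expanding_image:
  fixes g :: "real \<Rightarrow> 'a::metric_space"
  assumes S: "S \<in> sets borel" and gS: "g ` S \<subseteq> A" and c: "0 < c"
    and expand: "\<And>x y. x \<in> S \<Longrightarrow> y \<in> S \<Longrightarrow> c * \<bar>x - y\<bar> \<le> dist (g x) (g y)"
  shows "ennreal c * emeasure lborel S \<le> hausdorff1_outer A"
proof -
  have "ennreal c * emeasure lborel S \<le> hausdorff1_pre 1 A"
    unfolding hausdorff1_pre_def
  proof (rule INF_greatest, clarify)
    fix U :: "nat \<Rightarrow> 'a set"
    assume U: "A \<subseteq> (\<Union>n. U n)" "\<forall>n. ediam (U n) \<le> ennreal 1"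
    define T where "T n = {x \<in> S. g x \<in> U n}" for n
    define J where "J n = (if T n = {} then {} else {Inf (T n)..Sup (T n)})" for n
    have key: "T n \<subseteq> J n \<and> ennreal c * emeasure lborel (J n) \<le> ediam (U n)" for n
    proof (cases "T n = {}")
      case False
      then obtain z where z: "z \<in> T n" by blast
      define D where "D = enn2real (ediam (U n))"
      have "ediam (U n) < top"
        using U(2) ennreal_less_top le_less_trans by blast
      then have D: "ediam (U n) = ennreal D" "0 \<le> D" by (auto simp: D_def)
      have sep: "\<bar>x - y\<bar> \<le> D / c" if "x \<in> T n" "y \<in> T n" for x y
      proof -
        have "ennreal (dist (g x) (g y)) \<le> ennreal D"
          using that ediam_upper[of "g x" "U n" "g y"] D by (auto simp: T_def)
        then have "dist (g x) (g y) \<le> D" using D(2) by (simp add: ennreal_le_iff)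
        then have "c * \<bar>x - y\<bar> \<le> D" using expand[of x y] that by (auto simp: T_def)
        then show ?thesis using c by (simp add: field_simps)
      qed
      have bdd: "bdd_above (T n)" "bdd_below (T n)"
        using sep[OF z] by (auto intro!: bdd_aboveI[of _ "z + D / c"] bdd_belowI[of _ "z - D / c"]
            simp: abs_le_iff algebra_simps)
      have "x \<le> Inf (T n) + D / c" if "x \<in> T n" for x
      proof -
        have "x - D / c \<le> Inf (T n)"
          using False sep[OF that] by (intro cInf_greatest) (auto simp: abs_le_iff algebra_simps)
        then show ?thesis by simp
      qed
      then have "Sup (T n) \<le> Inf (T n) + D / c"
        using False by (intro cSup_least) auto
      then have "c * (Sup (T n) - Inf (T n)) \<le> D"
        using c by (simp add: field_simps)
      moreover have "Inf (T n) \<le> Sup (T n)"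
        using False bdd by (intro cInf_le_cSup)
      ultimately have "ennreal c * emeasure lborel (J n) \<le> ediam (U n)"
        using False c D by (simp add: J_def ennreal_mult[symmetric] ennreal_leI)
      then show ?thesis
        using False bdd by (auto simp: J_def intro: cInf_lower cSup_upper)
    qed (simp add: J_def)
    have "S \<subseteq> (\<Union>n. J n)"
    proof
      fix x assume x: "x \<in> S"
      then obtain n where "g x \<in> U n" using gS U(1) by blast
      then have "x \<in> T n" using x by (simp add: T_def)
      then show "x \<in> (\<Union>n. J n)" using key[of n] by blast
    qed
    moreover have Jb: "range J \<subseteq> sets lborel" by (auto simp: J_def)
    ultimately have "emeasure lborel S \<le> emeasure lborel (\<Union>n. J n)"
      by (intro emeasure_mono) auto
    also have "\<dots> \<le> (\<Sum>n. emeasure lborel (J n))"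
      by (rule emeasure_subadditive_countably[OF Jb])
    finally have "ennreal c * emeasure lborel S \<le> ennreal c * (\<Sum>n. emeasure lborel (J n))"
      by (rule mult_left_mono) simp
    also have "\<dots> = (\<Sum>n. ennreal c * emeasure lborel (J n))" by simp
    also have "\<dots> \<le> (\<Sum>n. ediam (U n))"
      using key by (intro suminf_le) auto
    finally show "ennreal c * emeasure lborel S \<le> (\<Sum>n. ediam (U n))" .
  qed
  also have "\<dots> \<le> hausdorff1_outer A"
    unfolding hausdorff1_outer_def by (rule SUP_upper) auto
  finally show ?thesis .
qed


section \<open>Binary digits and packing on the line\<close>

definition bin_digit :: "real \<Rightarrow> nat \<Rightarrow> bool" where
  "bin_digit x i \<longleftrightarrow> odd \<lfloor>x * 2 ^ Suc i\<rfloor>"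

lemma floor_double: "\<lfloor>2 * u\<rfloor> = 2 * \<lfloor>u\<rfloor> + of_bool (odd \<lfloor>2 * u\<rfloor>)" for u :: real
proof -
  have "\<lfloor>2 * u\<rfloor> = 2 * \<lfloor>u\<rfloor> \<or> \<lfloor>2 * u\<rfloor> = 2 * \<lfloor>u\<rfloor> + 1" by linarith
  then show ?thesis by auto
qed

lemma floor_eq_of_bin_digits:
  assumes "x \<in> {0..<1}" "y \<in> {0..<1}" "\<forall>i<k. bin_digit x i = bin_digit y i"
  shows "\<lfloor>x * 2 ^ k\<rfloor> = \<lfloor>y * 2 ^ k\<rfloor>"
  using assms(3)
proof (induction k)
  case 0
  have "\<lfloor>x\<rfloor> = 0" "\<lfloor>y\<rfloor> = 0" using assms(1,2) by (auto simp: floor_eq_iff)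
  then show ?case by simp
next
  case (Suc k)
  have "\<lfloor>x * 2 ^ k\<rfloor> = \<lfloor>y * 2 ^ k\<rfloor>" "bin_digit x k = bin_digit y k"
    using Suc by auto
  then show ?case
    using floor_double[of "x * 2 ^ k"] floor_double[of "y * 2 ^ k"]
    by (simp add: bin_digit_def mult.left_commute)
qed

lemma dist_le_of_bin_digits:
  assumes "x \<in> {0..<1}" "y \<in> {0..<1}" "\<forall>i<k. bin_digit x i = bin_digit y i"
  shows "\<bar>x - y\<bar> \<le> (1/2) ^ k"
proof -
  have "\<bar>x * 2 ^ k - y * 2 ^ k\<bar> < 1"
    using floor_eq_of_bin_digits[OF assms] by linarith
  also have "\<bar>x * 2 ^ k - y * 2 ^ k\<bar> = \<bar>x - y\<bar> * 2 ^ k"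
    by (simp add: abs_mult flip: left_diff_distrib)
  finally show ?thesis by (simp add: field_simps power_divide)
qed

lemma Sup_separated:
  fixes X Y :: "real set"
  assumes "X \<noteq> {}" "Y \<noteq> {}" "bdd_above X" "bdd_above Y"
    and sep: "\<And>x y. x \<in> X \<Longrightarrow> y \<in> Y \<Longrightarrow> d \<le> \<bar>x - y\<bar>"
  shows "d \<le> \<bar>Sup X - Sup Y\<bar>"
proof (rule ccontr)
  assume "\<not> ?thesis"
  then have e: "0 < d - \<bar>Sup X - Sup Y\<bar>" by simp
  obtain x where x: "x \<in> X" "Sup X - (d - \<bar>Sup X - Sup Y\<bar>) < x"
    using less_cSup_iff[OF assms(1,3), of "Sup X - (d - \<bar>Sup X - Sup Y\<bar>)"] e by auto
  obtain y where y: "y \<in> Y" "Sup Y - (d - \<bar>Sup X - Sup Y\<bar>) < y"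
    using less_cSup_iff[OF assms(2,4), of "Sup Y - (d - \<bar>Sup X - Sup Y\<bar>)"] e by auto
  have "x \<le> Sup X" "y \<le> Sup Y"
    using x y assms by (auto intro: cSup_upper)
  then show False using sep[OF x(1) y(1)] x(2) y(2) by linarith
qed

text \<open>
  Immediately to the right of the last point of a piece of level \<open>k\<close> there is a gap of length
  \<open>\<delta> k\<close> that no other piece of that level enters.  Its far part, at distance between
  \<open>\<delta> (Suc k)\<close> and \<open>\<delta> k\<close> from the piece, is moreover not reached by the gaps of the finer
  pieces.  These parts are therefore pairwise disjoint, over all pieces of all levels, and all of
  them lie in the surrounding interval, prolonged by \<open>\<delta> 0\<close>.
\<close>

lemma nested_separated_packing:
  fixes A :: "nat \<Rightarrow> 'w \<Rightarrow> real set"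
  assumes fin: "\<And>k. finite (W k)"
    and ne: "\<And>k w. w \<in> W k \<Longrightarrow> A k w \<noteq> {}"
    and sub: "\<And>k w. w \<in> W k \<Longrightarrow> A k w \<subseteq> {a..b}"
    and sep: "\<And>k w v s t. w \<in> W k \<Longrightarrow> v \<in> W k \<Longrightarrow> w \<noteq> v \<Longrightarrow> s \<in> A k w \<Longrightarrow> t \<in> A k v \<Longrightarrow> \<delta> k \<le> \<bar>s - t\<bar>"
    and nested: "\<And>k l v. k \<le> l \<Longrightarrow> v \<in> W l \<Longrightarrow> \<exists>w\<in>W k. A l v \<subseteq> A k w"
    and "antimono \<delta>" and pos: "\<And>k. 0 \<le> \<delta> k" and "a \<le> b"
  shows "(\<Sum>k<K. real (card (W k)) * (\<delta> k - \<delta> (Suc k))) \<le> b - a + \<delta> 0"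
proof -
  define m where "m k w = Sup (A k w)" for k w
  define G where "G = (\<lambda>(k, w). {m k w + \<delta> (Suc k)<..<m k w + \<delta> k})"
  have mono: "\<delta> l \<le> \<delta> k" if "k \<le> l" for k l
    using \<open>antimono \<delta>\<close> that by (auto dest: antimonoD)
  have bdd: "bdd_above (A k w)" if "w \<in> W k" for k w
    using sub[OF that] by (rule bdd_above_mono[OF bdd_above_Icc])
  have m_sep: "\<delta> k \<le> \<bar>m k w - m l v\<bar>"
    if "w \<in> W k" "v \<in> W l" "u \<in> W k" "A l v \<subseteq> A k u" "u \<noteq> w" for k l u v w
    unfolding m_def
  proof (rule Sup_separated)
    show "\<And>x y. x \<in> A k w \<Longrightarrow> y \<in> A l v \<Longrightarrow> \<delta> k \<le> \<bar>x - y\<bar>"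
      using sep[of w k u] that by blast
  qed (use that ne bdd in auto)
  have disj: "G (k, w) \<inter> G (l, v) = {}"
    if "k \<le> l" "w \<in> W k" "v \<in> W l" "(k, w) \<noteq> (l, v)" for k l v w
  proof (cases "k = l")
    case True
    then have "\<delta> k \<le> \<bar>m k w - m l v\<bar>" using m_sep[of w k v l v] that by auto
    then show ?thesis using pos[of "Suc k"] True by (auto simp: G_def)
  next
    case False
    then have kl: "\<delta> l \<le> \<delta> (Suc k)" using that(1) by (intro mono) simp
    obtain u where u: "u \<in> W k" "A l v \<subseteq> A k u"
      using nested[OF \<open>k \<le> l\<close> \<open>v \<in> W l\<close>] by blast
    show ?thesis
    proof (cases "u = w")
      case True
      have "m l v \<le> m k w"
        unfolding m_def using u True ne that bdd by (intro cSup_subset_mono) auto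
      then show ?thesis using kl by (auto simp: G_def)
    next
      case False
      then have "\<delta> k \<le> \<bar>m k w - m l v\<bar>" using m_sep u that by blast
      then show ?thesis using kl mono[of k l] that(1) pos[of "Suc k"] pos[of "Suc l"]
        by (auto simp: G_def)
    qed
  qed
  let ?P = "Sigma {..<K} W"
  have "disjoint_family_on G ?P"
    unfolding disjoint_family_on_def
  proof (intro ballI impI)
    fix i j assume ij: "i \<in> ?P" "j \<in> ?P" "i \<noteq> j"
    then obtain k w l v where eq: "i = (k, w)" "j = (l, v)" and *: "w \<in> W k" "v \<in> W l" "(k, w) \<noteq> (l, v)"
      by (cases i; cases j) auto
    have "G (k, w) \<inter> G (l, v) = {}"
    proof (cases "k \<le> l")
      case True then show ?thesis using * by (intro disj) auto
    next
      case False
      then have "G (l, v) \<inter> G (k, w) = {}" using * by (intro disj) auto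
      then show ?thesis by blast
    qed
    then show "G i \<inter> G j = {}" by (simp only: eq)
  qed
  moreover have "finite ?P" using fin by auto
  ultimately have "measure lborel (\<Union>i\<in>?P. G i) = (\<Sum>i\<in>?P. measure lborel (G i))"
    by (intro measure_finite_Union) (auto simp: G_def mono)
  also have "\<dots> = (\<Sum>(k, w)\<in>?P. \<delta> k - \<delta> (Suc k))"
    by (rule sum.cong) (auto simp: G_def mono)
  also have "\<dots> = (\<Sum>k<K. \<Sum>w\<in>W k. \<delta> k - \<delta> (Suc k))"
    using fin by (intro sum.Sigma[symmetric]) auto
  finally have "(\<Sum>k<K. real (card (W k)) * (\<delta> k - \<delta> (Suc k))) = measure lborel (\<Union>i\<in>?P. G i)"
    by simp
  also have "\<dots> \<le> measure lborel {a..b + \<delta> 0}"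
  proof (rule measure_mono_fmeasurable)
    show "(\<Union>i\<in>?P. G i) \<subseteq> {a..b + \<delta> 0}"
    proof
      fix x assume "x \<in> (\<Union>i\<in>?P. G i)"
      then obtain k w where *: "x \<in> G (k, w)" "w \<in> W k" by blast
      obtain z where z: "z \<in> A k w" using ne[OF *(2)] by blast
      have "a \<le> z" "z \<le> m k w"
        using z sub[OF *(2)] bdd[OF *(2)] by (auto simp: m_def intro: cSup_upper)
      moreover have "m k w \<le> b"
        unfolding m_def using sub[OF *(2)] ne[OF *(2)] by (intro cSup_least) auto
      ultimately show "x \<in> {a..b + \<delta> 0}"
        using *(1) mono[of 0 k] pos[of "Suc k"] by (auto simp: G_def)
    qed
    show "(\<Union>i\<in>?P. G i) \<in> sets lborel"
      using \<open>finite ?P\<close> by (intro sets.finite_UN) (auto simp: G_def)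
  qed (rule fmeasurable_compact[OF compact_Icc])
  also have "\<dots> = b - a + \<delta> 0" using \<open>a \<le> b\<close> pos[of 0] by simp
  finally show ?thesis .
qed

section \<open>Metric images of the Cantor tree\<close>

text \<open>
  The word of length \<open>n\<close> of a branch addresses the piece of level \<open>n\<close> in which the branch ends.
\<close>

definition word :: "nat \<Rightarrow> (nat \<Rightarrow> bool) \<Rightarrow> bool list" where
  "word n a = map a [0..<n]"

lemma word_eq_iff: "word n a = word n b \<longleftrightarrow> (\<forall>i<n. a i = b i)"
  by (auto simp: word_def)

lemma word_eq_mono: "word n a = word n b \<Longrightarrow> k \<le> n \<Longrightarrow> word k a = word k b"
  by (auto simp: word_eq_iff)

lemma finite_bool_words: "finite {w :: bool list. length w = n}"
  using finite_lists_length_eq[of "UNIV :: bool set" n] by simp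

lemma card_bool_words: "card {w :: bool list. length w = n} = 2 ^ n"
  using card_lists_length_eq[of "UNIV :: bool set" n] by simp

lemma first_difference:
  assumes "a \<noteq> (b :: nat \<Rightarrow> bool)"
  obtains k where "word k a = word k b" "a k \<noteq> b k"
proof -
  have ex: "\<exists>k. a k \<noteq> b k" using assms by auto
  have "word (LEAST k. a k \<noteq> b k) a = word (LEAST k. a k \<noteq> b k) b"
    by (auto simp: word_eq_iff dest: not_less_Least)
  then show thesis using that LeastI_ex[OF ex] by blast
qed

text \<open>
  A parametrization by branches that compares, up to constants, with the tree metric in which
  branches that split at depth \<open>n\<close> have distance \<open>2\<^sup>-\<^sup>n\<close>.
\<close>

locale cantor_tree =
  fixes e :: "(nat \<Rightarrow> bool) \<Rightarrow> 'a::metric_space" and c C :: real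
  assumes c_pos: "0 < c"
    and dist_ge: "\<And>n a b. word n a = word n b \<Longrightarrow> a n \<noteq> b n \<Longrightarrow> c * (1/2) ^ n \<le> dist (e a) (e b)"
    and dist_le: "\<And>n a b. word n a = word n b \<Longrightarrow> a n \<noteq> b n \<Longrightarrow> dist (e a) (e b) \<le> C * (1/2) ^ n"
begin

lemma C_pos: "0 < C"
  using c_pos dist_ge[of 0 "\<lambda>_. True" "\<lambda>_. False"] dist_le[of 0 "\<lambda>_. True" "\<lambda>_. False"]
  by (simp add: word_def)

lemma dist_le_of_word:
  assumes "word n a = word n b"
  shows "dist (e a) (e b) \<le> C * (1/2) ^ n"
proof (cases "a = b")
  case False
  then obtain k where k: "word k a = word k b" "a k \<noteq> b k" by (rule first_difference)
  have "n \<le> k"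
    using k(2) assms by (auto simp: word_eq_iff not_less[symmetric])
  then have "C * (1/2) ^ k \<le> C * (1/2) ^ n"
    using C_pos by (intro mult_left_mono power_decreasing) auto
  then show ?thesis using dist_le[OF k] by simp
qed (use C_pos in simp)

lemma dist_ge_of_word:
  assumes "word n a \<noteq> word n b"
  shows "c * (1/2) ^ n \<le> dist (e a) (e b)"
proof -
  have "a \<noteq> b" using assms by auto
  then obtain k where k: "word k a = word k b" "a k \<noteq> b k" by (rule first_difference)
  have "k \<le> n"
    using word_eq_mono[OF k(1), of n] assms by linarith
  then have "c * (1/2) ^ n \<le> c * (1/2) ^ k"
    using c_pos by (intro mult_left_mono power_decreasing) auto
  then show ?thesis using dist_ge[OF k] by simp
qed

lemma word_eq_of_dist:
  "dist (e a) (e b) < c * (1/2) ^ n \<Longrightarrow> word n a = word n b"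
  using dist_ge_of_word[of n a b] by force

definition piece :: "nat \<Rightarrow> (nat \<Rightarrow> bool) \<Rightarrow> 'a set" where
  "piece n a = e ` {b. word n b = word n a}"

lemma piece_0: "piece 0 a = range e"
  by (simp add: piece_def word_def)

lemma ediam_image_le:
  assumes "\<And>a b. a \<in> B \<Longrightarrow> b \<in> B \<Longrightarrow> word n a = word n b"
  shows "ediam (e ` B) \<le> ennreal (C * (1/2) ^ n)"
  unfolding ediam_def using assms by (auto intro!: SUP_least ennreal_leI dist_le_of_word)

text \<open>
  Points of the range that are close to a given point share a long word, so that a convergent
  sequence in the range determines the digits of a branch, which ends in its limit.
\<close>

lemma closed_range: "closed (range e)"
proof -
  have "x \<in> range e" if "x \<in> closure (range e)" for x
  proof -
    have "\<exists>a. dist (e a) x < c * (1/2) ^ n / 2" for n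
    proof -
      have "0 < c * (1/2) ^ n / 2" using c_pos by simp
      then show ?thesis using that unfolding closure_approachable by blast
    qed
    then obtain s where s: "\<And>n. dist (e (s n)) x < c * (1/2) ^ n / 2" by metis
    \<comment> \<open>From index \<open>Suc i\<close> onwards the branches agree on their first \<open>Suc i\<close> digits, the last of
      which is the digit at place \<open>i\<close>.\<close>
    define a where "a i = s (Suc i) i" for i
    have agree: "word n (s m) = word n (s n)" if "n \<le> m" for n m
    proof (rule word_eq_of_dist)
      have "c * (1/2) ^ m \<le> c * (1/2) ^ n"
        using c_pos that by (intro mult_left_mono power_decreasing) auto
      then have "dist (e (s m)) x < c * (1/2) ^ n / 2" using s[of m] by simp
      then show "dist (e (s m)) (e (s n)) < c * (1/2) ^ n"
        using s[of n] dist_triangle2[of "e (s m)" "e (s n)" x] by simp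
    qed
    have "word n a = word n (s n)" for n
      unfolding word_eq_iff
  proof (intro allI impI)
    fix i assume "i < n"
    then have "word (Suc i) (s n) = word (Suc i) (s (Suc i))" by (intro agree) simp
    then show "a i = s n i" by (simp add: word_eq_iff a_def)
  qed
    then have bound: "dist (e a) x \<le> C * (1/2) ^ n + c * (1/2) ^ n / 2" for n
      using dist_le_of_word[of n a "s n"] s[of n] dist_triangle[of "e a" x "e (s n)"] by force
    have "(\<lambda>n. C * (1/2) ^ n + c * (1/2) ^ n / 2) \<longlonglongrightarrow> C * 0 + c * 0 / 2"
      by (intro tendsto_intros LIMSEQ_power_zero) auto
    then have "dist (e a) x \<le> 0"
      using bound by (intro LIMSEQ_le_const[where a = "dist (e a) x"]) auto
    then show ?thesis by auto
  qed
  then show ?thesis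
    by (metis closure_subset closure_closed subsetI subset_antisym closed_closure)
qed

lemma ball_supset_piece:
  assumes "C * (1/2) ^ n < r"
  shows "piece n a \<subseteq> ball (e a) r \<inter> range e"
proof
  fix x assume "x \<in> piece n a"
  then obtain b where b: "x = e b" "word n b = word n a" by (auto simp: piece_def)
  then have "dist (e a) (e b) \<le> C * (1/2) ^ n" by (intro dist_le_of_word) simp
  then show "x \<in> ball (e a) r \<inter> range e" using assms b by simp
qed

lemma ball_subset_piece:
  assumes "r \<le> c * (1/2) ^ n"
  shows "ball (e a) r \<inter> range e \<subseteq> piece n a"
proof
  fix x assume "x \<in> ball (e a) r \<inter> range e"
  then obtain b where b: "x = e b" "dist (e a) (e b) < r" by auto
  then have "word n a = word n b" using assms by (intro word_eq_of_dist) simp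
  then show "x \<in> piece n a" using b by (auto simp: piece_def)
qed

text \<open>The subpieces that lie \<open>m\<close> levels further down give coverings of constant total size.\<close>

lemma hausdorff1_piece_le: "hausdorff1_outer (piece n a) \<le> ennreal (C * (1/2) ^ n)"
proof (rule hausdorff1_outer_le_of_covers[where I = "\<lambda>m. {w :: bool list. length w = m}"
      and U = "\<lambda>m w. e ` {b. word n b = word n a \<and> map b [n..<n + m] = w}"
      and d = "\<lambda>m. C * (1/2) ^ (n + m)"])
  show "piece n a \<subseteq> (\<Union>w\<in>{w. length w = m}. e ` {b. word n b = word n a \<and> map b [n..<n + m] = w})" for m
  proof
    fix x assume "x \<in> piece n a"
    then obtain b where "x = e b" "word n b = word n a" by (auto simp: piece_def)
    then show "x \<in> (\<Union>w\<in>{w. length w = m}. e ` {b. word n b = word n a \<and> map b [n..<n + m] = w})"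
      by (intro UN_I[of "map b [n..<n + m]"]) auto
  qed
  show "ediam (e ` {b. word n b = word n a \<and> map b [n..<n + m] = w}) \<le> ennreal (C * (1/2) ^ (n + m))"
    for m and w :: "bool list"
  proof (rule ediam_image_le)
    fix b b' assume *: "b \<in> {b. word n b = word n a \<and> map b [n..<n + m] = w}"
      "b' \<in> {b. word n b = word n a \<and> map b [n..<n + m] = w}"
    then have "word n b = word n b'" "map b [n..<n + m] = map b' [n..<n + m]" by simp_all
    then show "word (n + m) b = word (n + m) b'"
      unfolding word_def using upt_add_eq_append[of 0 n m] by simp
  qed
  have "(\<lambda>m. C * (1/2) ^ n * (1/2) ^ m) \<longlonglongrightarrow> C * (1/2) ^ n * 0"
    by (intro tendsto_mult tendsto_const LIMSEQ_power_zero) simp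
  then show "(\<lambda>m. C * (1/2) ^ (n + m)) \<longlonglongrightarrow> 0" by (simp add: power_add mult.assoc)
  have "real (card {w :: bool list. length w = m}) * (C * (1/2) ^ (n + m)) = C * (1/2) ^ n" for m
    by (simp add: card_bool_words power_add power_divide)
  then show "(\<lambda>m. real (card {w :: bool list. length w = m}) * (C * (1/2) ^ (n + m))) \<longlonglongrightarrow> C * (1/2) ^ n"
    by (simp only: tendsto_const)
qed (use C_pos finite_bool_words in auto)

text \<open>
  Reading off binary digits below the piece maps \<open>[0, 1)\<close> into the piece.  Numbers whose digits
  first differ at place \<open>k\<close> are at most \<open>2\<^sup>-\<^sup>k\<close> apart, whereas their images are at
  distance at least \<open>c 2\<^sup>-\<^sup>n\<^sup>-\<^sup>k\<close>; so this map expands.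
\<close>

lemma hausdorff1_piece_ge: "ennreal (c * (1/2) ^ n) \<le> hausdorff1_outer (piece n a)"
proof -
  define branch where "branch x i = (if i < n then a i else bin_digit x (i - n))" for x i
  have "ennreal (c * (1/2) ^ n) * emeasure lborel {0..<1::real} \<le> hausdorff1_outer (piece n a)"
  proof (rule hausdorff1_outer_expanding_image[where g = "\<lambda>x. e (branch x)"])
    show "(\<lambda>x. e (branch x)) ` {0..<1} \<subseteq> piece n a"
      by (auto simp: piece_def word_eq_iff branch_def)
    fix x y :: real assume xy: "x \<in> {0..<1}" "y \<in> {0..<1}"
    show "c * (1/2) ^ n * \<bar>x - y\<bar> \<le> dist (e (branch x)) (e (branch y))"
    proof (cases "bin_digit x = bin_digit y")
      case True
      have "\<bar>x - y\<bar> \<le> (1/2) ^ k" for k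
        using True xy by (intro dist_le_of_bin_digits) auto
      then have "\<bar>x - y\<bar> \<le> 0"
        by (intro LIMSEQ_le_const[OF LIMSEQ_power_zero[of "1/2 :: real"]]) auto
      then show ?thesis by simp
    next
      case False
      then obtain k where k: "word k (bin_digit x) = word k (bin_digit y)" "bin_digit x k \<noteq> bin_digit y k"
        by (rule first_difference)
      have "\<bar>x - y\<bar> \<le> (1/2) ^ k"
        using k(1) xy by (intro dist_le_of_bin_digits) (auto simp: word_eq_iff)
      then have "c * (1/2) ^ n * \<bar>x - y\<bar> \<le> c * (1/2) ^ n * (1/2) ^ k"
        using c_pos by (intro mult_left_mono) auto
      also have "\<dots> = c * (1/2) ^ (n + k)" by (simp add: power_add)
      also have "\<dots> \<le> dist (e (branch x)) (e (branch y))"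
      proof (rule dist_ge)
        show "word (n + k) (branch x) = word (n + k) (branch y)"
          using k(1) by (auto simp: word_eq_iff branch_def)
      qed (use k(2) in \<open>simp add: branch_def\<close>)
      finally show ?thesis .
    qed
  qed (use c_pos in auto)
  then show ?thesis by simp
qed

theorem emeasure_range_finite: "emeasure hausdorff1 (range e) < top"
proof -
  have "hausdorff1_outer (range e) \<le> ennreal C"
    using hausdorff1_piece_le[of 0] by (simp add: piece_0)
  then show ?thesis
    using closed_range by (simp add: emeasure_hausdorff1 borel_closed le_less_trans)
qed

theorem ahlfors_regular_range: "ahlfors_regular1 (range e)"
proof -
  have borel: "range e \<in> sets borel" using closed_range by (rule borel_closed)
  have ball_borel: "ball p r \<inter> range e \<in> sets borel" for p r using borel by auto
  have diam: "ediam (range e) \<le> ennreal C"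
    using ediam_image_le[of UNIV 0] by (simp add: word_def)
  have "ennreal c \<le> ennreal (dist (e (\<lambda>_. True)) (e (\<lambda>_. False)))"
    using dist_ge[of 0 "\<lambda>_. True" "\<lambda>_. False"] by (intro ennreal_leI) (simp add: word_def)
  also have "\<dots> \<le> ediam (range e)" by (intro ediam_upper) auto
  finally have diam_pos: "0 < ediam (range e)"
    by (rule less_le_trans[rotated]) (use c_pos in simp)
  \<comment> \<open>The dyadic scale just below a given radius.\<close>
  have scale: "\<exists>n. t * (1/2) ^ n < r \<and> r \<le> 2 * (t * (1/2) ^ n)" if "0 < r" "r \<le> t" for r t :: real
  proof -
    have "\<exists>n. (1/2) ^ n < r / t"
      using that by (intro real_arch_pow_inv) auto
    then have ex: "\<exists>n. t * (1/2) ^ n < r" using that by (simp add: field_simps)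
    define n where "n = (LEAST n. t * (1/2) ^ n < r)"
    have n: "t * (1/2) ^ n < r" unfolding n_def by (rule LeastI_ex[OF ex])
    then obtain m where m: "n = Suc m" using n \<open>r \<le> t\<close> by (cases n) auto
    have "\<not> t * (1/2) ^ m < r"
      using m not_less_Least[of m "\<lambda>n. t * (1/2) ^ n < r"] by (simp add: n_def)
    then show ?thesis using n m by (intro exI[of _ n]) auto
  qed
  have lower: "ennreal (c / (2 * C) * r) \<le> emeasure hausdorff1 (ball (e a) r \<inter> range e)"
    if r: "0 < r" "ennreal r \<le> ediam (range e)" for a r
  proof -
    have "r \<le> C" using order.trans[OF r(2) diam] C_pos by (simp add: ennreal_le_iff)
    then obtain n where n: "C * (1/2) ^ n < r" "r \<le> 2 * (C * (1/2) ^ n)"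
      using scale r(1) by blast
    have "c / (2 * C) * r \<le> c * (1/2) ^ n"
      using mult_left_mono[OF n(2), of "c / (2 * C)"] c_pos C_pos by simp
    then have "ennreal (c / (2 * C) * r) \<le> ennreal (c * (1/2) ^ n)" by (rule ennreal_leI)
    also have "\<dots> \<le> hausdorff1_outer (piece n a)" by (rule hausdorff1_piece_ge)
    also have "\<dots> \<le> hausdorff1_outer (ball (e a) r \<inter> range e)"
      by (intro hausdorff1_outer_mono ball_supset_piece n(1))
    finally show ?thesis by (simp add: emeasure_hausdorff1 ball_borel)
  qed
  have upper: "emeasure hausdorff1 (ball (e a) r \<inter> range e) \<le> ennreal (2 * C / c * r)"
    if "0 < r" for a r
  proof -
    \<comment> \<open>Small balls are confined to one piece by the separation of pieces, at the first scale above
      the radius; for radii beyond \<open>c\<close> the whole range, which is the piece of level \<open>0\<close>, is small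
      enough.\<close>
    obtain n where n: "C * (1/2) ^ n \<le> 2 * C / c * r" "ball (e a) r \<inter> range e \<subseteq> piece n a"
    proof (cases "r \<le> c")
      case True
      then obtain k where k: "c * (1/2) ^ k < r" "r \<le> 2 * (c * (1/2) ^ k)"
        using scale \<open>0 < r\<close> by blast
      show thesis
      proof (cases k)
        case 0
        then show thesis using k True by simp
      next
        case (Suc n)
        have "c * (1/2) ^ n \<le> 2 * r" using k(1) Suc by simp
        then have "C / c * (c * (1/2) ^ n) \<le> C / c * (2 * r)"
          using c_pos C_pos by (intro mult_left_mono) auto
        moreover have "r \<le> c * (1/2) ^ n" using k(2) Suc by simp
        ultimately show thesis using c_pos ball_subset_piece by (intro that[of n]) (auto simp: mult_ac)
      qed
    next
      case False
      then have "C / c * c \<le> C / c * (2 * r)"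
        using c_pos C_pos by (intro mult_left_mono) auto
      then show thesis using c_pos by (intro that[of 0]) (auto simp: piece_0 mult_ac)
    qed
    have "hausdorff1_outer (ball (e a) r \<inter> range e) \<le> hausdorff1_outer (piece n a)"
      by (rule hausdorff1_outer_mono[OF n(2)])
    also have "\<dots> \<le> ennreal (C * (1/2) ^ n)" by (rule hausdorff1_piece_le)
    also have "\<dots> \<le> ennreal (2 * C / c * r)" by (rule ennreal_leI[OF n(1)])
    finally show ?thesis by (simp add: emeasure_hausdorff1 ball_borel)
  qed
  show ?thesis
    unfolding ahlfors_regular1_def
  proof (intro conjI borel diam_pos exI[of _ "2 * C / c"] ballI allI impI)
    show "0 < 2 * C / c" using c_pos C_pos by simp
    fix p r assume "p \<in> range e" "0 < r \<and> ennreal r \<le> ediam (range e)"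
    moreover have "r / (2 * C / c) = c / (2 * C) * r" by simp
    ultimately show "ennreal (r / (2 * C / c)) \<le> emeasure hausdorff1 (ball p r \<inter> range e)"
      "emeasure hausdorff1 (ball p r \<inter> range e) \<le> ennreal (2 * C / c * r)"
      using lower upper by (auto simp only:)
  qed
qed

text \<open>
  Suppose that a Lipschitz curve meets \<open>N\<^sub>k\<close> pieces of level \<open>k\<close> during a bounded time interval.
  The times spent in different pieces of level \<open>k\<close> are separated by a multiple of \<open>2\<^sup>-\<^sup>k\<close>, so
  by packing the sum of all \<open>N\<^sub>k 2\<^sup>-\<^sup>k\<close> is finite, and \<open>N\<^sub>k 2\<^sup>-\<^sup>k\<close> tends to zero.
  But, up to a constant, that is the total diameter of these pieces, which cover the part of the
  range that the curve meets.
\<close>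

theorem purely_unrectifiable_range: "purely_unrectifiable1 (range e)"
  unfolding purely_unrectifiable1_def
proof (intro allI impI)
  fix f :: "real \<Rightarrow> 'a" assume "\<exists>L. L-lipschitz_on UNIV f"
  then obtain L0 where L0: "L0-lipschitz_on UNIV f" by blast
  \<comment> \<open>Division by the Lipschitz constant requires it to be positive.\<close>
  define L where "L = L0 + 1"
  have L: "0 < L" "dist (f s) (f t) \<le> L * \<bar>s - t\<bar>" for s t
    using lipschitz_onD[OF L0, of s t] lipschitz_on_nonneg[OF L0]
    by (auto simp: L_def dist_real_def algebra_simps)
  have bounded_time: "hausdorff1_outer (range e \<inter> f ` {-b..b}) = 0" if "0 \<le> b" for b
  proof -
    define A where "A k w = {s \<in> {-b..b}. \<exists>a. f s = e a \<and> word k a = w}" for k w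
    define W where "W k = {w. A k w \<noteq> {}}" for k
    define \<delta> where "\<delta> k = c * (1/2) ^ k / L" for k :: nat
    have "W k \<subseteq> {w. length w = k}" for k
      by (auto simp: W_def A_def word_def)
    then have finW: "finite (W k)" for k
      using finite_bool_words by (rule finite_subset)
    have packing: "(\<Sum>k<K. real (card (W k)) * (\<delta> k - \<delta> (Suc k))) \<le> b - (- b) + \<delta> 0" for K
    proof (rule nested_separated_packing[where A = A])
      show "finite (W k)" for k by (rule finW)
      show "A k w \<noteq> {}" if "w \<in> W k" for k w using that by (simp add: W_def)
      show "A k w \<subseteq> {- b..b}" for k w by (auto simp: A_def)
      show "\<delta> k \<le> \<bar>s - t\<bar>" if wv: "w \<noteq> v" "s \<in> A k w" "t \<in> A k v" for k w v s t
      proof -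
        obtain p q where "f s = e p" "f t = e q" "word k p \<noteq> word k q"
          using wv unfolding A_def by blast
        then have "c * (1/2) ^ k \<le> L * \<bar>s - t\<bar>"
          using dist_ge_of_word[of k p q] L(2)[of s t] by simp
        then show ?thesis using L(1) by (simp add: \<delta>_def field_simps)
      qed
      show "\<exists>w\<in>W k. A l v \<subseteq> A k w" if "k \<le> l" "v \<in> W l" for k l v
      proof -
        have "A l v \<subseteq> A k (take k v)"
          using \<open>k \<le> l\<close> by (auto simp: A_def word_def take_map)
        then show ?thesis using \<open>v \<in> W l\<close> by (auto simp: W_def)
      qed
      show "antimono \<delta>"
        unfolding \<delta>_def using c_pos L(1)
        by (intro antimonoI divide_right_mono mult_left_mono power_decreasing) auto
      show "0 \<le> \<delta> k" for k using c_pos L(1) by (simp add: \<delta>_def)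
    qed (use that in auto)
    have half: "\<delta> k - \<delta> (Suc k) = c / (2 * L) * (1/2) ^ k" for k
      using L(1) by (simp add: \<delta>_def field_simps)
    have "summable (\<lambda>k. real (card (W k)) * (\<delta> k - \<delta> (Suc k)))"
      using packing c_pos L(1) by (intro summableI_nonneg_bounded) (auto simp: half)
    then have "(\<lambda>k. real (card (W k)) * (\<delta> k - \<delta> (Suc k))) \<longlonglongrightarrow> 0"
      by (rule summable_LIMSEQ_zero)
    then have "(\<lambda>k. C * (2 * L) / c * (real (card (W k)) * (\<delta> k - \<delta> (Suc k)))) \<longlonglongrightarrow> C * (2 * L) / c * 0"
      by (intro tendsto_mult tendsto_const)
    then have lim: "(\<lambda>k. real (card (W k)) * (C * (1/2) ^ k)) \<longlonglongrightarrow> 0"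
      using c_pos L(1) by (simp add: half mult_ac)
    have "hausdorff1_outer (range e \<inter> f ` {-b..b}) \<le> ennreal 0"
    proof (rule hausdorff1_outer_le_of_covers[where I = W and U = "\<lambda>k w. e ` {a. word k a = w}"
          and d = "\<lambda>k. C * (1/2) ^ k"])
      show "range e \<inter> f ` {-b..b} \<subseteq> (\<Union>w\<in>W k. e ` {a. word k a = w})" for k
      proof
        fix x assume "x \<in> range e \<inter> f ` {-b..b}"
        then obtain a s where *: "x = e a" "x = f s" "s \<in> {-b..b}" by blast
        then have "s \<in> A k (word k a)" by (auto simp: A_def intro: sym)
        then have "word k a \<in> W k" by (auto simp: W_def)
        then show "x \<in> (\<Union>w\<in>W k. e ` {a. word k a = w})"
          using *(1) by auto
      qed
      show "ediam (e ` {a. word k a = w}) \<le> ennreal (C * (1/2) ^ k)" for k w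
        by (rule ediam_image_le) simp
      have "(\<lambda>k. C * (1/2) ^ k) \<longlonglongrightarrow> C * 0"
        by (intro tendsto_mult tendsto_const LIMSEQ_power_zero) simp
      then show "(\<lambda>k. C * (1/2) ^ k) \<longlonglongrightarrow> 0" by simp
    qed (use finW lim C_pos in auto)
    then show ?thesis by simp
  qed
  have "range e \<inter> range f \<subseteq> (\<Union>n::nat. range e \<inter> f ` {- real n..real n})"
  proof
    fix x assume "x \<in> range e \<inter> range f"
    then obtain s where s: "x \<in> range e" "x = f s" by blast
    obtain n :: nat where "\<bar>s\<bar> \<le> real n" using real_arch_simple by blast
    then have "s \<in> {- real n..real n}" by auto
    then show "x \<in> (\<Union>n::nat. range e \<inter> f ` {- real n..real n})" using s by blast
  qed
  then have "hausdorff1_outer (range e \<inter> range f) \<le> hausdorff1_outer (\<Union>n::nat. range e \<inter> f ` {- real n..real n})"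
    by (rule hausdorff1_outer_mono)
  also have "\<dots> \<le> (\<Sum>n::nat. hausdorff1_outer (range e \<inter> f ` {- real n..real n}))"
    by (rule hausdorff1_outer_subadd)
  also have "\<dots> = 0" by (simp add: bounded_time)
  finally show "hausdorff1_outer (range e \<inter> range f) = 0" by simp
qed

end


section \<open>Bounded kernels on sets of finite measure\<close>

lemma (in finite_measure) square_integral_abs_le:
  fixes f :: "'a \<Rightarrow> real"
  assumes f[measurable]: "f \<in> borel_measurable M" and f2: "integrable M (\<lambda>x. (f x)\<^sup>2)"
  shows "(\<integral>x. \<bar>f x\<bar> \<partial>M)\<^sup>2 \<le> measure M (space M) * (\<integral>x. (f x)\<^sup>2 \<partial>M)"
proof -
  have int: "integrable M (\<lambda>x. \<bar>f x\<bar>)"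
    using square_integrable_imp_integrable[OF f f2] by simp
  have "(\<integral>\<^sup>+x. ennreal \<bar>f x\<bar> * 1 \<partial>M)\<^sup>2 \<le> (\<integral>\<^sup>+x. (ennreal \<bar>f x\<bar>)\<^sup>2 \<partial>M) * (\<integral>\<^sup>+x. 1\<^sup>2 \<partial>M)"
    by (rule Cauchy_Schwarz_nn_integral) auto
  also have "(\<integral>\<^sup>+x. ennreal \<bar>f x\<bar> * 1 \<partial>M) = ennreal (\<integral>x. \<bar>f x\<bar> \<partial>M)"
    using nn_integral_eq_integral[OF int] by simp
  also have "(\<integral>\<^sup>+x. (ennreal \<bar>f x\<bar>)\<^sup>2 \<partial>M) = ennreal (\<integral>x. (f x)\<^sup>2 \<partial>M)"
    using nn_integral_eq_integral[OF f2] by (simp add: ennreal_power)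
  also have "(\<integral>\<^sup>+x. 1\<^sup>2 \<partial>M) = ennreal (measure M (space M))"
    by (simp add: emeasure_eq_measure)
  finally show ?thesis
    by (simp add: ennreal_power ennreal_mult[symmetric] ennreal_le_iff mult.commute)
qed

text \<open>
  On a set of finite measure, a bounded kernel sends \<open>L\<^sup>2\<close> to bounded functions, by the
  Cauchy--Schwarz inequality, with constants that do not depend on the truncation.  Measurability is
  asked for only between points of the set, where a parametrization can provide it.
\<close>

lemma sio_bounded_L2_of_bounded_kernel:
  fixes E :: "heis set"
  defines "N \<equiv> restrict_space hausdorff1 E"
  assumes E: "E \<in> sets borel" and fin: "emeasure hausdorff1 E < top"
    and K: "(\<lambda>x. K (- fst x + snd x)) \<in> borel_measurable (N \<Otimes>\<^sub>M N)"
    and dist: "(\<lambda>x. dist (fst x) (snd x)) \<in> borel_measurable (N \<Otimes>\<^sub>M N)"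
    and bound: "\<And>p q. p \<in> E \<Longrightarrow> q \<in> E \<Longrightarrow> \<bar>K (- p + q)\<bar> \<le> B"
  shows "sio_bounded_L2 K E"
proof -
  have EN: "E \<inter> space hausdorff1 \<in> sets hausdorff1" using E by simp
  have space_N: "space N = E" by (simp add: N_def space_restrict_space)
  interpret finite_measure N
  proof (rule finite_measureI)
    have "emeasure N (space N) = emeasure hausdorff1 E"
      unfolding N_def using EN by (simp add: emeasure_restrict_space space_restrict_space)
    then show "emeasure N (space N) \<noteq> \<infinity>" using fin by simp
  qed
  define V where "V = measure N (space N)"
  have V: "0 \<le> V" by (simp add: V_def)
  \<comment> \<open>For empty \<open>E\<close> the constant \<open>B\<close> may be negative.\<close>
  define B' where "B' = max B 0"
  have B': "0 \<le> B'" "\<bar>K (- p + q)\<bar> \<le> B'" if "p \<in> E" "q \<in> E" for p q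
    using bound[OF that] by (auto simp: B'_def)
  have B'0: "0 \<le> B'" by (simp add: B'_def)
  have main: "truncated_sio K E \<epsilon> f \<in> L2 N \<and> L2_norm N (truncated_sio K E \<epsilon> f) \<le> (V * B' + 1) * L2_norm N f"
    if "f \<in> L2 N" for \<epsilon> f
  proof -
    have f[measurable]: "f \<in> borel_measurable N" and f2: "integrable N (\<lambda>x. (f x)\<^sup>2)"
      using that by (auto simp: L2_def)
    define h where "h p q = (if \<epsilon> \<le> dist p q then K (- p + q) * f q else 0)" for p q
    define T where "T = truncated_sio K E \<epsilon> f"
    have T_eq: "T p = (\<integral>q. h p q \<partial>N)" for p
      unfolding T_def truncated_sio_def set_lebesgue_integral_def N_def integral_restrict_space[OF EN]
      by (rule Bochner_Integration.integral_cong) (auto simp: h_def indicator_def)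
    have "case_prod h \<in> borel_measurable (N \<Otimes>\<^sub>M N)"
      unfolding h_def case_prod_beta using K dist by measurable
    then have T_meas[measurable]: "T \<in> borel_measurable N"
      unfolding T_eq[abs_def] by (rule borel_measurable_lebesgue_integral)
    define m where "m = (\<integral>q. \<bar>f q\<bar> \<partial>N)"
    have int: "integrable N (\<lambda>x. \<bar>f x\<bar>)"
      using square_integrable_imp_integrable[OF f f2] by simp
    have T_le: "\<bar>T p\<bar> \<le> B' * m" if "p \<in> E" for p
    proof -
      have "\<bar>T p\<bar> \<le> (\<integral>q. \<bar>h p q\<bar> \<partial>N)" unfolding T_eq by (rule integral_abs_bound)
      also have "\<dots> \<le> (\<integral>q. B' * \<bar>f q\<bar> \<partial>N)"
      proof (rule integral_mono')
        fix q assume "q \<in> space N"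
        then show "\<bar>h p q\<bar> \<le> B' * \<bar>f q\<bar>"
          using B' \<open>p \<in> E\<close> by (auto simp: h_def abs_mult space_N intro!: mult_right_mono)
      qed (use int B'0 in auto)
      finally show ?thesis by (simp add: m_def)
    qed
    have T2_le: "(T p)\<^sup>2 \<le> (B' * m)\<^sup>2" if "p \<in> E" for p
      using T_le[OF that] by (metis abs_ge_zero power2_abs power_mono)
    have T2: "integrable N (\<lambda>p. (T p)\<^sup>2)"
      using T2_le by (intro integrable_const_bound[where B = "(B' * m)\<^sup>2"] AE_I2) (auto simp: space_N)
    have "(\<integral>p. (T p)\<^sup>2 \<partial>N) \<le> (\<integral>p. (B' * m)\<^sup>2 \<partial>N)"
      using T2 T2_le by (intro integral_mono) (auto simp: space_N)
    also have "\<dots> = V * B'\<^sup>2 * m\<^sup>2" by (simp add: V_def power_mult_distrib)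
    also have "\<dots> \<le> V * B'\<^sup>2 * (V * (\<integral>x. (f x)\<^sup>2 \<partial>N))"
      using square_integral_abs_le[OF f f2] V by (intro mult_left_mono) (auto simp: m_def V_def)
    also have "\<dots> = (V * B')\<^sup>2 * (\<integral>x. (f x)\<^sup>2 \<partial>N)" by (simp add: power2_eq_square)
    finally have "L2_norm N T \<le> V * B' * L2_norm N f"
      using V B'0 unfolding L2_norm_def
      by (metis (no_types, lifting) abs_of_nonneg mult_nonneg_nonneg real_sqrt_abs real_sqrt_le_iff real_sqrt_mult)
    also have "\<dots> \<le> (V * B' + 1) * L2_norm N f"
      by (intro mult_right_mono) (auto simp: L2_norm_def)
    finally show ?thesis
      using T2 T_meas by (simp add: T_def[symmetric] L2_def)
  qed
  have "0 < V * B' + 1" using V B'0 by (simp add: add_nonneg_pos)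
  then show ?thesis
    unfolding sio_bounded_L2_def N_def[symmetric] using main by blast
qed


section \<open>A Cantor set on the diagonal of the xz-plane\<close>

definition diag :: "real \<Rightarrow> heis" where
  "diag t = Heis t 0 t"

lemma minus_diag_plus: "- diag s + diag t = diag (t - s)"
  by (simp add: diag_def uminus_heis_def plus_heis_def)

lemma koranyi_diag: "koranyi (diag t) = root 4 (t ^ 4 + t\<^sup>2)"
  by (simp add: koranyi_def diag_def flip: power_mult)

lemma dist_diag: "dist (diag s) (diag t) = root 4 ((s - t) ^ 4 + (s - t)\<^sup>2)"
  by (simp only: dist_heis_def minus_diag_plus koranyi_diag)

lemma K_b_diag_nonzero: "t \<noteq> 0 \<Longrightarrow> K_b (diag t) \<noteq> 0"
  by (simp add: K_b_def diag_def zero_heis_def)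

text \<open>
  The square of the Koranyi norm dominates the \<open>z\<close>-coordinate, which on the diagonal equals the
  \<open>x\<close>-coordinate.
\<close>

lemma K_b_diag_le: "\<bar>K_b (diag t)\<bar> \<le> 1"
proof -
  have "\<bar>t\<bar> \<le> (koranyi (diag t))\<^sup>2"
    unfolding koranyi_sq using abs_Im_le_cmod[of "Complex ((hx (diag t))\<^sup>2 + (hy (diag t))\<^sup>2) (hz (diag t))"]
    by (simp add: diag_def)
  then show ?thesis
    by (simp add: K_b_def diag_def divide_le_eq_1)
qed

text \<open>
  The points with quaternary digits \<open>0\<close> and \<open>1\<close>; the branch is read from the units digit onwards.
\<close>

definition base4 :: "(nat \<Rightarrow> bool) \<Rightarrow> real" where
  "base4 a = (\<Sum>i. of_bool (a i) * (1/4) ^ i)"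

lemma base4_split: "\<exists>r. base4 a = (\<Sum>i<n. of_bool (a i) * (1/4) ^ i) + r \<and> 0 \<le> r \<and> r \<le> 4/3 * (1/4) ^ n"
proof -
  have geo: "summable (\<lambda>i. (1/4 :: real) ^ i)" "(\<Sum>i. (1/4 :: real) ^ i) = 4/3"
    using summable_geometric[of "1/4 :: real"] suminf_geometric[of "1/4 :: real"] by auto
  have sm: "summable (\<lambda>i. of_bool (a i) * (1/4 :: real) ^ i)" for a
    by (rule summable_comparison_test'[OF geo(1), of 0]) auto
  define r where "r = (\<Sum>i. of_bool (a (i + n)) * (1/4 :: real) ^ i)"
  have r: "0 \<le> r" "r \<le> 4/3"
    unfolding r_def geo(2)[symmetric] by (auto intro!: suminf_nonneg suminf_le sm geo)
  have "base4 a = (\<Sum>i. of_bool (a (i + n)) * (1/4) ^ (i + n)) + (\<Sum>i<n. of_bool (a i) * (1/4) ^ i)"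
    unfolding base4_def by (rule suminf_split_initial_segment[OF sm])
  also have "(\<Sum>i. of_bool (a (i + n)) * (1/4 :: real) ^ (i + n)) = (\<Sum>i. (1/4) ^ n * (of_bool (a (i + n)) * (1/4) ^ i))"
    by (intro suminf_cong) (simp add: power_add)
  also have "\<dots> = (1/4) ^ n * r"
    unfolding r_def by (rule suminf_mult[OF sm[of "\<lambda>i. a (i + n)"]])
  finally show ?thesis using r by (intro exI[of _ "(1/4) ^ n * r"]) auto
qed

text \<open>
  All digits after the first difference together contribute at most a third of that difference,
  so they can neither cancel it nor more than slightly enlarge it.
\<close>

lemma base4_difference:
  assumes "word n a = word n b" "a n \<noteq> b n"
  shows "2/3 * (1/4) ^ n \<le> \<bar>base4 a - base4 b\<bar>" "\<bar>base4 a - base4 b\<bar> \<le> 4/3 * (1/4) ^ n"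
proof -
  have prefix: "(\<Sum>i<n. of_bool (a i) * (1/4 :: real) ^ i) = (\<Sum>i<n. of_bool (b i) * (1/4) ^ i)"
    using assms(1) by (intro sum.cong) (auto simp: word_eq_iff)
  obtain r where r: "base4 a = (\<Sum>i<Suc n. of_bool (a i) * (1/4) ^ i) + r" "0 \<le> r" "r \<le> 4/3 * (1/4) ^ Suc n"
    using base4_split by blast
  obtain s where s: "base4 b = (\<Sum>i<Suc n. of_bool (b i) * (1/4) ^ i) + s" "0 \<le> s" "s \<le> 4/3 * (1/4) ^ Suc n"
    using base4_split by blast
  have "base4 a - base4 b = (of_bool (a n) - of_bool (b n)) * (1/4) ^ n + (r - s)"
    using r(1) s(1) prefix by (simp add: algebra_simps)
  then show "2/3 * (1/4) ^ n \<le> \<bar>base4 a - base4 b\<bar>" "\<bar>base4 a - base4 b\<bar> \<le> 4/3 * (1/4) ^ n"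
    using assms(2) r(2,3) s(2,3) by (cases "a n"; cases "b n"; simp; linarith)+
qed

text \<open>
  With \<open>q = 4\<^sup>-\<^sup>n\<close>, the fourth power \<open>u\<^sup>4 + u\<^sup>2\<close> of the distance lies between \<open>q\<^sup>2 / 16\<close> and
  \<open>16 q\<^sup>2\<close>, since \<open>u\<close> lies between \<open>2q/3\<close> and \<open>4q/3\<close> and \<open>q \<le> 1\<close>.
\<close>

interpretation cantor: cantor_tree "\<lambda>a. diag (base4 a)" "1/2" 2
proof
  fix n and a b :: "nat \<Rightarrow> bool"
  assume ab: "word n a = word n b" "a n \<noteq> b n"
  define u where "u = \<bar>base4 a - base4 b\<bar>"
  define q :: real where "q = (1/4) ^ n"
  have q: "0 < q" "q \<le> 1" by (simp_all add: q_def power_le_one)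
  have u: "2/3 * q \<le> u" "u \<le> 4/3 * q"
    using base4_difference[OF ab] by (simp_all add: u_def q_def)
  have d: "dist (diag (base4 a)) (diag (base4 b)) = root 4 (u ^ 4 + u\<^sup>2)"
    by (simp add: dist_diag u_def power_even_abs)
  have root: "x * (1/2) ^ n = root 4 (x ^ 4 * q\<^sup>2)" if "0 \<le> x" for x :: real
  proof -
    have "q = ((1/2) ^ n)\<^sup>2"
      by (simp add: q_def power2_eq_square flip: power_mult_distrib)
    moreover have "(y\<^sup>2)\<^sup>2 = y ^ 4" for y :: real
      by (simp flip: power_mult)
    ultimately have "x ^ 4 * q\<^sup>2 = (x * (1/2) ^ n) ^ 4"
      by (simp only: power_mult_distrib)
    then show ?thesis using that by (simp add: real_root_power_cancel)
  qed
  have u2: "(2/3 * q)\<^sup>2 \<le> u\<^sup>2" "u\<^sup>2 \<le> (4/3 * q)\<^sup>2"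
    using u q by (auto intro!: power_mono)
  have "(1/2) ^ 4 * q\<^sup>2 \<le> u ^ 4 + u\<^sup>2"
  proof -
    have "(1/2) ^ 4 * q\<^sup>2 \<le> (2/3 * q)\<^sup>2" by (simp add: power2_eq_square power4_eq_xxxx)
    also have "\<dots> \<le> u ^ 4 + u\<^sup>2" using u2(1) by (simp add: add_increasing)
    finally show ?thesis .
  qed
  then show "1/2 * (1/2) ^ n \<le> dist (diag (base4 a)) (diag (base4 b))"
    unfolding d by (subst root) auto
  have "u ^ 4 \<le> 256/81 * q\<^sup>2"
  proof -
    have "u ^ 4 \<le> (4/3 * q) ^ 4" using u q by (intro power_mono) auto
    also have "\<dots> = (4/3) ^ 4 * q\<^sup>2 * q\<^sup>2" by (simp add: power2_eq_square power4_eq_xxxx)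
    also have "\<dots> \<le> (4/3) ^ 4 * q\<^sup>2 * 1" using q by (intro mult_left_mono power_le_one) auto
    finally show ?thesis by (simp add: power_divide)
  qed
  moreover have "u\<^sup>2 \<le> 16/9 * q\<^sup>2" using u2(2) by (simp add: power_mult_distrib power_divide)
  ultimately have "u ^ 4 + u\<^sup>2 \<le> 16 * q\<^sup>2"
    using zero_le_power2[of q] by linarith
  then show "dist (diag (base4 a)) (diag (base4 b)) \<le> 2 * (1/2) ^ n"
    unfolding d by (subst root) auto
qed simp

text \<open>
  Between points of the diagonal both the kernel and the distance are functions of the difference
  of the \<open>x\<close>-coordinates; this gives their measurability on the product.
\<close>

lemma sio_bounded_L2_K_b_diag:
  assumes E: "E \<in> sets borel" "E \<subseteq> range diag" and fin: "emeasure hausdorff1 E < top"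
  shows "sio_bounded_L2 K_b E"
proof -
  define N where "N = restrict_space hausdorff1 E"
  have "1-lipschitz_on UNIV hx"
  proof (rule lipschitz_onI)
    fix p q :: heis
    have "\<bar>hx p - hx q\<bar> = root 4 ((hx p - hx q) ^ 4)"
      using real_root_power_cancel[of 4 "\<bar>hx p - hx q\<bar>"] by (simp add: power_even_abs)
    also have "\<dots> \<le> root 4 (((hx p - hx q)\<^sup>2 + (hy p - hy q)\<^sup>2)\<^sup>2)"
    proof -
      have "((hx p - hx q)\<^sup>2)\<^sup>2 \<le> ((hx p - hx q)\<^sup>2 + (hy p - hy q)\<^sup>2)\<^sup>2"
        by (intro power_mono) auto
      then show ?thesis by simp
    qed
    also have "\<dots> \<le> dist p q"
      by (simp add: dist_heis_def koranyi_def plus_heis_def uminus_heis_def)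
    finally show "dist (hx p) (hx q) \<le> 1 * dist p q" by (simp add: dist_real_def)
  qed simp
  then have "hx \<in> borel_measurable borel"
    by (intro borel_measurable_continuous_onI lipschitz_on_continuous_on)
  then have "hx \<in> borel_measurable hausdorff1"
    by (subst measurable_cong_sets[OF sets_hausdorff1 refl])
  then have hx[measurable]: "hx \<in> borel_measurable N"
    unfolding N_def by (rule measurable_restrict_space1)
  have diag_hx: "diag (hx p) = p" if "p \<in> E" for p
    using that E(2) by (auto simp: diag_def)
  have space: "x \<in> space (N \<Otimes>\<^sub>M N) \<Longrightarrow> fst x \<in> E \<and> snd x \<in> E" for x
    by (auto simp: N_def space_pair_measure space_restrict_space)
  have K_eq: "K_b (- p + q) = K_b (diag (hx q - hx p))" if "p \<in> E" "q \<in> E" for p q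
    using minus_diag_plus[of "hx p" "hx q"] diag_hx that by simp
  have dist_eq: "dist p q = root 4 ((hx p - hx q) ^ 4 + (hx p - hx q)\<^sup>2)" if "p \<in> E" "q \<in> E" for p q
    using dist_diag[of "hx p" "hx q"] diag_hx that by simp
  have root[measurable]: "root 4 \<in> borel_measurable borel"
    by (intro borel_measurable_continuous_onI continuous_intros)
  show ?thesis
  proof (rule sio_bounded_L2_of_bounded_kernel[OF E(1) fin])
    have "(\<lambda>x. \<bar>hx (snd x) - hx (fst x)\<bar> / (root 4 ((hx (snd x) - hx (fst x)) ^ 4 + (hx (snd x) - hx (fst x))\<^sup>2))\<^sup>2)
        \<in> borel_measurable (N \<Otimes>\<^sub>M N)"
      by measurable
    moreover have "K_b (- fst x + snd x) = \<bar>hx (snd x) - hx (fst x)\<bar>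
        / (root 4 ((hx (snd x) - hx (fst x)) ^ 4 + (hx (snd x) - hx (fst x))\<^sup>2))\<^sup>2"
      if "x \<in> space (N \<Otimes>\<^sub>M N)" for x
      using K_eq[of "fst x" "snd x"] space[OF that] by (simp add: K_b_def koranyi_diag) (simp add: diag_def)
    ultimately show "(\<lambda>x. K_b (- fst x + snd x)) \<in> borel_measurable (restrict_space hausdorff1 E \<Otimes>\<^sub>M restrict_space hausdorff1 E)"
      unfolding N_def[symmetric] by (simp cong: measurable_cong)
    have "(\<lambda>x. root 4 ((hx (fst x) - hx (snd x)) ^ 4 + (hx (fst x) - hx (snd x))\<^sup>2)) \<in> borel_measurable (N \<Otimes>\<^sub>M N)"
      by measurable
    then show "(\<lambda>x. dist (fst x) (snd x)) \<in> borel_measurable (restrict_space hausdorff1 E \<Otimes>\<^sub>M restrict_space hausdorff1 E)"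
      unfolding N_def[symmetric] using dist_eq space by (simp cong: measurable_cong)
    show "\<bar>K_b (- p + q)\<bar> \<le> 1" if "p \<in> E" "q \<in> E" for p q
      using K_eq[OF that] K_b_diag_le by simp
  qed
qed

theorem theorem1p6:
  shows "\<exists>E :: heis set.
    ahlfors_regular1 E \<and>
    purely_unrectifiable1 E \<and>
    sio_bounded_L2 K_b E \<and>
    (\<forall>p\<in>E. (\<lambda>q. - p + q) ` E - {0} \<subseteq> {v. K_b v \<noteq> 0})"
proof (intro exI[of _ "range (\<lambda>a. diag (base4 a))"] conjI ballI)
  show "ahlfors_regular1 (range (\<lambda>a. diag (base4 a)))"
    by (rule cantor.ahlfors_regular_range)
  show "purely_unrectifiable1 (range (\<lambda>a. diag (base4 a)))"
    by (rule cantor.purely_unrectifiable_range)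
  show "sio_bounded_L2 K_b (range (\<lambda>a. diag (base4 a)))"
    by (intro sio_bounded_L2_K_b_diag borel_closed cantor.closed_range cantor.emeasure_range_finite) auto
  fix p assume "p \<in> range (\<lambda>a. diag (base4 a))"
  then obtain s where p: "p = diag s" by auto
  show "(\<lambda>q. - p + q) ` range (\<lambda>a. diag (base4 a)) - {0} \<subseteq> {v. K_b v \<noteq> 0}"
  proof
    fix v assume "v \<in> (\<lambda>q. - p + q) ` range (\<lambda>a. diag (base4 a)) - {0}"
    then obtain t where "v = diag (t - s)" "v \<noteq> 0" by (auto simp: p minus_diag_plus)
    moreover from this have "t - s \<noteq> 0" by (auto simp: diag_def zero_heis_def)
    ultimately show "v \<in> {v. K_b v \<noteq> 0}" using K_b_diag_nonzero by simp
  qed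
qed

end
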